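(* Let $n\ge 2$, let $\Omega\subset\mathbb{R}^n$ be a John domain, and let $s\in(0,1)$, $1\le q\le\frac{n}{n-s}$, $a\ge 0$ and $b\in\mathbb{R}$ with $b\le\frac{n+a}{q}-n+s$. Then there exists a constant $C>0$, independent of $f$, such that for every $f\in C^\infty(\Omega)$ $$ \inf_{c\in\mathbb{R}}\|f-c\|_{L^q(\Omega,d^a)}\le C\int_\Omega\int_{|x-z|\le d(x)/2}\frac{|f(z)-f(x)|}{|z-x|^{n+s}}\,\delta(x,z)^b\,dz\,dx. $$
   Context: $d(x)=\mathrm{dist}(x,\partial\Omega)$ for $x\in\Omega$; $\delta(x,z)=\min\{d(x),d(z)\}$; $\|g\|_{L^q(\Omega,d^a)}=\left(\int_\Omega |g(y)|^q d(y)^a\,dy\right)^{1/q}$. Both sides of the inequality are allowed to take the value $+\infty$. John domain: it is assumed that $0\in\Omega$. A bounded domain $\Omega\subset\mathbb{R}^n$ is a John domain if there exist a family of rectifiable curves $\gamma(t,y)$, $0\le t\le 1$, $y\in\Omega$, and positive constants $\lambda,K,C_0$ such that: (1) $\gamma(0,y)=y$ and $\gamma(1,y)=0$; (2) $d(\gamma(t,y))\ge\lambda t$; (3) $|\dot\gamma(t,y)|\le K$, where the dot denotes the derivative in $t$; (4) for all $x,y\in\Omega$ and $r\le\frac12 d(x)$, $\ell(\gamma(y)\cap B(x,r))\le C_0 r$, where $\gamma(y)$ denotes the curve $\gamma(\cdot,y)$ joining $y$ with $0$ and $\ell$ denotes length. *)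

theory Defs
  imports "HOL-Analysis.Analysis"
begin

text \<open>The distance to the boundary, \<open>d(x)\<close>, and \<open>\<delta>(x,z) = min {d(x), d(z)}\<close>.\<close>

definition bdist :: "'a::metric_space set \<Rightarrow> 'a \<Rightarrow> real" where
  "bdist \<Omega> x = infdist x (frontier \<Omega>)"

definition bdist2 :: "'a::metric_space set \<Rightarrow> 'a \<Rightarrow> 'a \<Rightarrow> real" where
  "bdist2 \<Omega> x z = min (bdist \<Omega> x) (bdist \<Omega> z)"

text \<open>
  The length of the part of the curve \<open>g\<close> traced out over the parameter set \<open>T\<close>, as the total
  variation of \<open>g\<close>: the supremum over all finite families of non-overlapping compact intervals
  contained in \<open>T\<close>. This is the usual length if \<open>T\<close> is an interval, and the sum of the lengths over
  the components if \<open>T\<close> is relatively open in an interval.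
\<close>

definition curve_length :: "(real \<Rightarrow> 'a::real_normed_vector) \<Rightarrow> real set \<Rightarrow> ennreal" where
  "curve_length g T =
    (SUP D\<in>{D. D division_of \<Union>D \<and> \<Union>D \<subseteq> T}. \<Sum>I\<in>D. ennreal (norm (g (Sup I) - g (Inf I))))"

definition rectifiable_path :: "(real \<Rightarrow> 'a::real_normed_vector) \<Rightarrow> bool" where
  "rectifiable_path g \<longleftrightarrow> path g \<and> curve_length g {0..1} < \<infinity>"

text \<open>
  A rectifiable curve need not be differentiable everywhere, so \<open>|d\<gamma>/dt| \<le> K\<close> is required at almost
  every \<open>t\<close>, for a Lipschitz curve. Without absolute continuity the almost-everywhere bound would be
  void: a continuous curve of finite length may have derivative 0 almost everywhere. A curve that is
  differentiable on all of \<open>[0,1]\<close> with \<open>|d\<gamma>/dt| \<le> K\<close> satisfies this condition.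
\<close>

definition speed_bounded :: "(real \<Rightarrow> 'a::real_normed_vector) \<Rightarrow> real \<Rightarrow> bool" where
  "speed_bounded g K \<longleftrightarrow>
    (\<exists>L. L-lipschitz_on {0..1} g) \<and>
    (AE t in lborel. t \<in> {0<..<1} \<longrightarrow>
      (\<exists>v. (g has_vector_derivative v) (at t) \<and> norm v \<le> K))"

definition John_domain :: "'a::euclidean_space set \<Rightarrow> bool" where
  "John_domain \<Omega> \<longleftrightarrow>
    open \<Omega> \<and> connected \<Omega> \<and> bounded \<Omega> \<and> 0 \<in> \<Omega> \<and>
    (\<exists>(\<gamma> :: real \<Rightarrow> 'a \<Rightarrow> 'a) (lam::real) (K::real) (C0::real).
      lam > 0 \<and> K > 0 \<and> C0 > 0 \<and>
      (\<forall>y\<in>\<Omega>. rectifiable_path (\<lambda>t. \<gamma> t y) \<and> (\<forall>t\<in>{0..1}. \<gamma> t y \<in> \<Omega>)) \<and>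
      (\<forall>y\<in>\<Omega>. \<gamma> 0 y = y \<and> \<gamma> 1 y = 0) \<and>
      (\<forall>y\<in>\<Omega>. \<forall>t\<in>{0..1}. bdist \<Omega> (\<gamma> t y) \<ge> lam * t) \<and>
      (\<forall>y\<in>\<Omega>. speed_bounded (\<lambda>t. \<gamma> t y) K) \<and>
      (\<forall>x\<in>\<Omega>. \<forall>y\<in>\<Omega>. \<forall>r. 0 < r \<and> r \<le> bdist \<Omega> x / 2 \<longrightarrow>
        curve_length (\<lambda>t. \<gamma> t y) {t\<in>{0..1}. \<gamma> t y \<in> ball x r} \<le> ennreal (C0 * r)))"

text \<open>
  \<open>C\<^sup>k\<close> on an open set: for \<open>k + 1\<close>, all directional derivatives are \<open>C\<^sup>k\<close>.
\<close>

primrec Ck_on :: "nat \<Rightarrow> 'a::real_normed_vector set \<Rightarrow> ('a \<Rightarrow> 'b::real_normed_vector) \<Rightarrow> bool" where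
  "Ck_on 0 S f \<longleftrightarrow> continuous_on S f"
| "Ck_on (Suc k) S f \<longleftrightarrow>
    (\<forall>x\<in>S. f differentiable (at x)) \<and>
    (\<forall>v. Ck_on k S (\<lambda>x. frechet_derivative f (at x) v))"

definition Cinf_on :: "'a::real_normed_vector set \<Rightarrow> ('a \<Rightarrow> 'b::real_normed_vector) \<Rightarrow> bool" where
  "Cinf_on S f \<longleftrightarrow> (\<forall>k. Ck_on k S f)"

text \<open>Real powers on \<open>[0,\<infinity>]\<close>, meant for exponents \<open>p > 0\<close>.\<close>

definition epowr :: "ennreal \<Rightarrow> real \<Rightarrow> ennreal" where
  "epowr x p = (if x = \<infinity> then \<infinity> else ennreal (enn2real x powr p))"

definition wLq_norm :: "'a::euclidean_space set \<Rightarrow> real \<Rightarrow> real \<Rightarrow> ('a \<Rightarrow> real) \<Rightarrow> ennreal" where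
  "wLq_norm \<Omega> q a g =
    epowr (\<integral>\<^sup>+y\<in>\<Omega>. ennreal (\<bar>g y\<bar> powr q * bdist \<Omega> y powr a) \<partial>lborel) (1 / q)"

end

theory Submission
  imports Defs
begin

text \<open>
  The right-hand side is a fractional total variation: the exponent of \<open>\<bar>f(z) - f(x)\<bar>\<close> is 1. Hence it obeys
  a coarea formula: \<open>\<bar>f(z) - f(x)\<bar>\<close> is the length of the interval of levels \<open>t\<close> that separate the two
  values, so the double integral dominates the integral over \<open>t\<close> of the perimeters \<open>P(t)\<close> of the sets
  \<open>E = {f > t}\<close>, where the perimeter is the same double integral over the pairs that leave \<open>E\<close>
  (\<open>fractional_coarea\<close>). The inequality thus reduces to an isoperimetric inequality, for the weighted
  volume \<open>w(E) = \<integral>\<^sub>E d\<^sup>a\<close> and for open sets \<open>E\<close> that fill at most half of a fixed central ball: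
  \<open>w(E)\<^sup>1\<^sup>/\<^sup>q \<le> C P(E)\<close> (\<open>John_fractional_isoperimetric\<close>). Subtracting from \<open>f\<close> a median on that
  ball makes all superlevel sets at positive levels, of \<open>f - m\<close> and of \<open>m - f\<close>, satisfy the condition on
  \<open>E\<close>. For an indicator function there is no difference between weak and strong type bounds, which is why
  the critical exponent \<open>q = n/(n-s)\<close> is reached; the strong bound for \<open>f\<close> comes back by integrating over
  the levels (\<open>nn_integral_powr_le_of_level_sets\<close>).

  The isoperimetric inequality is proved by following, from a point \<open>y \<in> E\<close>, the John curve to 0 and watching
  the fraction that \<open>E\<close> fills of the balls \<open>B t\<close> of radius comparable to \<open>t\<close> about \<open>\<gamma>(t,y)\<close>. It is 1
  near \<open>t = 0\<close> and at most 1/2 at \<open>t = 1\<close>, so at some scale it crosses 1/2, and there a fixed part of a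
  ball of radius about \<open>t\<close> lies in \<open>E\<close> and a fixed part of a neighbouring one outside
  (\<open>John_domain_crossing\<close>). Such a crossing costs a perimeter of order \<open>t\<^sup>n\<^sup>-\<^sup>s D\<^sup>b\<close>, where
  \<open>D = max {d(y), t}\<close> is the order of the distance to the boundary, and under the hypotheses on \<open>q\<close> and \<open>b\<close>
  this pays for the weighted volume \<open>t\<^sup>n D\<^sup>a\<close> of the surrounding ball
  (\<open>weighted_volume_le_energy_powr\<close>). Vitali's covering lemma selects disjoint balls of this kind that
  cover \<open>E\<close> after enlargement, and because \<open>q \<ge> 1\<close> the local inequalities add up
  (\<open>vitali_energy_sum\<close>).
\<close>

section \<open>Curves of bounded speed\<close>

text \<open>
  If \<open>h\<close> increased from \<open>h u\<close> to \<open>h v\<close>, it would attain every value in between. A Lipschitz map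
  sends the exceptional null set \<open>N\<close> to a null set, so some intermediate value \<open>c\<close> is attained only
  at points with a negative derivative. Just after the last time at which it equals \<open>c\<close>, the
  function would have to be below \<open>c\<close> and yet end above it.
\<close>

lemma lipschitz_neg_deriv_ae_imp_nonincreasing:
  fixes h :: "real \<Rightarrow> real"
  assumes lip: "L-lipschitz_on {u..v} h" and uv: "u \<le> v" and N: "negligible N"
    and deriv: "\<And>t. t \<in> {u<..<v} - N \<Longrightarrow> \<exists>h'<0. (h has_real_derivative h') (at t)"
  shows "h v \<le> h u"
proof (rule ccontr)
  assume less: "\<not> h v \<le> h u"
  have cont: "continuous_on {u..v} h"
    using lip by (rule lipschitz_on_continuous_on)
  have "negligible (h ` (N \<inter> {u..v}))"
  proof (rule negligible_locally_Lipschitz_image)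
    show "negligible (N \<inter> {u..v})" using N by (rule negligible_subset) auto
    show "\<exists>T B. open T \<and> x \<in> T \<and> (\<forall>y\<in>N \<inter> {u..v} \<inter> T. norm (h y - h x) \<le> B * norm (y - x))"
      if "x \<in> N \<inter> {u..v}" for x
      using that lipschitz_on_normD[OF lip] by (intro exI[of _ UNIV] exI[of _ L]) auto
  qed simp
  moreover have "\<not> negligible {h u<..<h v}"
    using less by (simp add: open_not_negligible)
  ultimately obtain c where c: "c \<in> {h u<..<h v}" "c \<notin> h ` (N \<inter> {u..v})"
    using negligible_subset by blast
  define S where "S = {t \<in> {u..v}. h t = c}"
  have "compact S"
    unfolding S_def using continuous_closed_preimage_constant[OF cont, of c]
    by (auto simp: compact_eq_bounded_closed intro: bounded_subset[of "{u..v}"])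
  moreover have "S \<noteq> {}"
    using IVT'[of h u c v] c uv cont by (auto simp: S_def)
  ultimately obtain t where t: "t \<in> S" "\<And>x. x \<in> S \<Longrightarrow> x \<le> t"
    using compact_attains_sup by metis
  have htc: "h t = c" and tuv: "u \<le> t" "t \<le> v" using t by (auto simp: S_def)
  with c have "t \<noteq> u" "t \<noteq> v" "t \<notin> N" by auto
  with tuv have "t \<in> {u<..<v} - N" by auto
  then obtain h' where h': "h' < 0" "(h has_real_derivative h') (at t)" using deriv by blast
  obtain d where d: "d > 0" "\<And>e. 0 < e \<Longrightarrow> e < d \<Longrightarrow> h t > h (t + e)"
    using DERIV_neg_dec_right[OF h'(2,1)] by blast
  define e where "e = min (d/2) ((v - t)/2)"
  have e: "0 < e" "e < d" "t + e < v"
    using d(1) tuv \<open>t \<noteq> v\<close> by (auto simp: e_def min_def field_simps)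
  have "h (t + e) < c" using d(2)[OF e(1,2)] htc by simp
  moreover have "continuous_on {t+e..v} h"
    using cont by (rule continuous_on_subset) (use tuv e in auto)
  ultimately obtain w where "t + e \<le> w" "w \<le> v" "h w = c"
    using IVT'[of h "t+e" c v] c e by auto
  then have "w \<in> S" using tuv e by (auto simp: S_def)
  with t(2)[of w] \<open>t + e \<le> w\<close> e show False by simp
qed

text \<open>
  The Lipschitz constant in \<^const>\<open>speed_bounded\<close> is unrelated to \<open>K\<close> and may depend on the curve;
  the a.e. bound on the speed improves it to \<open>K\<close>. Projecting on the direction \<open>w\<close> of the increment and
  subtracting \<open>(K + e) t\<close> gives a real function with negative derivative a.e., to which the previous
  lemma applies.
\<close>

lemma speed_bounded_imp_norm_diff_le:
  fixes g :: "real \<Rightarrow> 'a::euclidean_space"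
  assumes sb: "speed_bounded g K" and st: "0 \<le> u" "u \<le> v" "v \<le> 1"
  shows "norm (g v - g u) \<le> K * (v - u)"
proof (rule field_le_epsilon)
  fix e :: real assume e: "e > 0"
  obtain L where L: "L-lipschitz_on {0..1} g"
    using sb by (auto simp: speed_bounded_def)
  define w where "w = sgn (g v - g u)"
  have w1: "norm w \<le> 1" by (simp add: w_def norm_sgn)
  define h where "h = (\<lambda>t. w \<bullet> g t - (K + e) * t)"
  have L0: "L \<ge> 0" using L by (rule lipschitz_on_nonneg)
  have lip: "(L + \<bar>K + e\<bar>)-lipschitz_on {u..v} h"
  proof (rule lipschitz_onI)
    fix x y assume xy: "x \<in> {u..v}" "y \<in> {u..v}"
    have "\<bar>w \<bullet> (g x - g y)\<bar> \<le> norm w * norm (g x - g y)" by (rule Cauchy_Schwarz_ineq2)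
    also have "\<dots> \<le> 1 * norm (g x - g y)" by (rule mult_right_mono) (use w1 in auto)
    also have "norm (g x - g y) \<le> L * \<bar>x - y\<bar>"
      using lipschitz_on_normD[OF L, of x y] xy st by auto
    finally have 1: "\<bar>w \<bullet> (g x - g y)\<bar> \<le> L * \<bar>x - y\<bar>" by simp
    have "h x - h y = w \<bullet> (g x - g y) - (K + e) * (x - y)"
      by (simp add: h_def inner_diff_right algebra_simps)
    then have "\<bar>h x - h y\<bar> \<le> \<bar>w \<bullet> (g x - g y)\<bar> + \<bar>K + e\<bar> * \<bar>x - y\<bar>"
      by (metis abs_triangle_ineq4 abs_mult)
    with 1 show "dist (h x) (h y) \<le> (L + \<bar>K + e\<bar>) * dist x y"
      by (simp add: dist_real_def algebra_simps)
  qed (use L0 in auto)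
  obtain N where N: "negligible N"
    and N': "\<And>t. t \<in> {0<..<1} - N \<Longrightarrow> \<exists>v. (g has_vector_derivative v) (at t) \<and> norm v \<le> K"
  proof -
    have "AE t in lborel. t \<in> {0<..<1} \<longrightarrow> (\<exists>v. (g has_vector_derivative v) (at t) \<and> norm v \<le> K)"
      using sb by (auto simp: speed_bounded_def)
    then obtain N where "{t \<in> space lborel. \<not> (t \<in> {0<..<1} \<longrightarrow>
        (\<exists>v. (g has_vector_derivative v) (at t) \<and> norm v \<le> K))} \<subseteq> N"
        "N \<in> sets lborel" "emeasure lborel N = 0"
      by (elim AE_E) auto
    then show ?thesis
      using that[of N] by (auto simp: negligible_iff_null_sets null_setsI null_sets_completionI)
  qed
  have "h v \<le> h u"
  proof (rule lipschitz_neg_deriv_ae_imp_nonincreasing[OF lip st(2) N])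
    fix t assume "t \<in> {u<..<v} - N"
    then have "t \<in> {0<..<1} - N" using st by auto
    then obtain g' where g': "(g has_vector_derivative g') (at t)" "norm g' \<le> K"
      using N' by blast
    have "((\<lambda>t. w \<bullet> g t) has_vector_derivative w \<bullet> g') (at t)"
      by (rule bounded_linear.has_vector_derivative[OF bounded_linear_inner_right g'(1)])
    then have "(h has_real_derivative w \<bullet> g' - (K + e)) (at t)"
      unfolding h_def has_real_derivative_iff_has_vector_derivative[symmetric]
      by (auto intro!: derivative_eq_intros)
    moreover have "w \<bullet> g' \<le> norm w * norm g'" by (rule norm_cauchy_schwarz)
    moreover have "norm w * norm g' \<le> 1 * norm g'" by (rule mult_right_mono) (use w1 in auto)
    ultimately show "\<exists>h'<0. (h has_real_derivative h') (at t)"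
      using g'(2) e by (intro exI[of _ "w \<bullet> g' - (K + e)"]) auto
  qed
  then have "w \<bullet> (g v - g u) \<le> (K + e) * (v - u)"
    by (simp add: h_def inner_diff_right algebra_simps)
  moreover have "w \<bullet> (g v - g u) = norm (g v - g u)"
    by (cases "g v = g u")
      (simp_all add: w_def sgn_div_norm power2_norm_eq_inner[symmetric] power2_eq_square)
  moreover have "e * (v - u) \<le> e * 1" using e st by (intro mult_left_mono) auto
  ultimately show "norm (g v - g u) \<le> K * (v - u) + e" by (simp add: algebra_simps)
qed

section \<open>The distance to the boundary\<close>

lemma bdist_diff_le: "\<bar>bdist \<Omega> x - bdist \<Omega> y\<bar> \<le> dist x y"
  unfolding bdist_def by (rule infdist_triangle_abs)

lemma bdist_nonneg [simp]: "0 \<le> bdist \<Omega> x"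
  by (simp add: bdist_def infdist_nonneg)

lemma measurable_bdist [measurable]: "bdist \<Omega> \<in> borel_measurable borel"
  unfolding bdist_def by (intro borel_measurable_continuous_onI continuous_intros)

context
  fixes \<Omega> :: "'a::euclidean_space set"
  assumes op: "open \<Omega>" and bd: "bounded \<Omega>" and zero: "0 \<in> \<Omega>"
begin

lemma frontier_nonempty_of_bounded_open: "frontier \<Omega> \<noteq> {}"
  using op bd zero by (metis bounded_subset empty_iff frontier_eq_empty not_bounded_UNIV)

lemma ball_bdist_subset:
  assumes "x \<in> \<Omega>" "dist x y < bdist \<Omega> x" shows "y \<in> \<Omega>"
proof (rule ccontr)
  assume "y \<notin> \<Omega>"
  have "closed_segment x y \<inter> frontier \<Omega> \<noteq> {}"
    by (rule connected_Int_frontier) (use assms \<open>y \<notin> \<Omega>\<close> in auto)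
  then obtain z where z: "z \<in> closed_segment x y" "z \<in> frontier \<Omega>" by blast
  then have "bdist \<Omega> x \<le> dist x z" by (simp add: bdist_def infdist_le)
  also have "\<dots> \<le> dist x y" using z(1) by (metis dist_commute segment_bound(1) dist_norm)
  finally show False using assms by simp
qed

lemma bdist_pos: "x \<in> \<Omega> \<Longrightarrow> 0 < bdist \<Omega> x"
  unfolding bdist_def
  by (rule infdist_pos_not_in_closed)
     (use frontier_nonempty_of_bounded_open op in \<open>auto simp: frontier_def interior_open\<close>)

lemma bdist_bounded: obtains M where "M > 0" "\<And>x. x \<in> \<Omega> \<Longrightarrow> bdist \<Omega> x \<le> M"
proof -
  obtain p where p: "p \<in> frontier \<Omega>" using frontier_nonempty_of_bounded_open by blast
  obtain B where B: "B > 0" "\<And>x. x \<in> \<Omega> \<Longrightarrow> norm x \<le> B" using bd by (auto simp: bounded_pos)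
  have "bdist \<Omega> x \<le> B + norm p" if "x \<in> \<Omega>" for x
  proof -
    have "bdist \<Omega> x \<le> dist x p" using p by (simp add: bdist_def infdist_le)
    also have "\<dots> \<le> norm x + norm p" by (simp add: dist_norm norm_triangle_ineq4)
    finally show ?thesis using B(2)[OF that] by simp
  qed
  then show ?thesis using that[of "B + norm p"] B(1) by (simp add: add_pos_nonneg)
qed

end

section \<open>Crossing from a set to its complement along a John curve\<close>

lemma measure_diff_bounded:
  fixes A E :: "'a::euclidean_space set"
  assumes "A \<in> sets borel" "E \<in> sets borel" "bounded A"
  shows "measure lborel (A - E) = measure lborel A - measure lborel (E \<inter> A)"
proof -
  have "emeasure lborel A < \<infinity>" using assms(3) by (rule emeasure_bounded_finite)
  then have "measure lborel (A - (E \<inter> A)) = measure lborel A - measure lborel (E \<inter> A)"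
    using assms by (intro measure_Diff) auto
  moreover have "A - (E \<inter> A) = A - E" by auto
  ultimately show ?thesis by simp
qed

text \<open>
  The local configuration at a point \<open>y\<close> of a set \<open>E\<close>: at scale \<open>t\<close> and within distance \<open>R t\<close> of \<open>y\<close>
  a piece \<open>A\<close> of \<open>E\<close> faces a piece \<open>G\<close> of the complement, both of volume at least \<open>c t\<^sup>n\<close>, so
  close together that all pairs in \<open>A \<times> G\<close> are seen by the double integral. On \<open>A\<close> and \<open>G\<close> the distance
  to the boundary is comparable to \<open>max {d(y), t}\<close>, so the weights are constant there up to a factor.
\<close>

definition crossing_pair ::
    "'a::euclidean_space set \<Rightarrow> real \<Rightarrow> real \<Rightarrow> real \<Rightarrow> 'a set \<Rightarrow> 'a \<Rightarrow> real \<Rightarrow> 'a set \<Rightarrow> 'a set \<Rightarrow> bool" where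
  "crossing_pair \<Omega> c R \<kappa> E y t A G \<longleftrightarrow>
    0 < t \<and> t \<le> 1 \<and> A \<in> sets borel \<and> G \<in> sets borel \<and>
    A \<subseteq> E \<inter> ball y (R * t) \<and> G \<inter> E = {} \<and> bounded G \<and>
    c * t ^ DIM('a) \<le> measure lborel A \<and> c * t ^ DIM('a) \<le> measure lborel G \<and>
    (\<forall>x\<in>A. \<forall>z\<in>G. norm (x - z) \<le> bdist \<Omega> x / 2 \<and> norm (x - z) \<le> R * t) \<and>
    (\<forall>x\<in>A \<union> G. max (bdist \<Omega> y) t \<le> \<kappa> * bdist \<Omega> x \<and> bdist \<Omega> x \<le> \<kappa> * max (bdist \<Omega> y) t)"

text \<open>
  Let \<open>B t\<close> be the ball of radius \<open>lam t / 16\<close> about the point \<open>\<gamma>(t,y)\<close> of the John curve. By the cone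
  condition \<open>d(\<gamma>(t,y)) \<ge> lam t\<close> it lies well inside the domain. For small \<open>t\<close> the ball is contained in
  the open set \<open>E\<close>, while \<open>B 1 = ball 0 r\<close> is at most half filled by \<open>E\<close>. Along the geometric sequence of
  times \<open>\<rho>\<^sup>j\<close> there is therefore a \<open>t\<close> such that \<open>E\<close> fills more than half of \<open>B (\<rho> t)\<close> but at most half
  of \<open>B t\<close>. With \<open>\<rho>\<close> close enough to 1, depending on \<open>lam\<close> and the speed bound \<open>K\<close> only, these
  two balls are so close together that \<open>A = E \<inter> B (\<rho> t)\<close>, \<open>G = B t - E\<close> form a crossing pair.
\<close>

lemma John_domain_crossing:
  fixes \<Omega> :: "'a::euclidean_space set"
  assumes J: "John_domain \<Omega>"
  obtains r R c \<kappa> :: real where "r > 0" "R > 0" "c > 0" "\<kappa> \<ge> 1" "cball 0 r \<subseteq> \<Omega>"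
    "\<And>E y. open E \<Longrightarrow> E \<subseteq> \<Omega> \<Longrightarrow> y \<in> E \<Longrightarrow>
      measure lborel (E \<inter> ball 0 r) \<le> measure lborel (ball 0 r :: 'a set) / 2 \<Longrightarrow>
      \<exists>t A G. crossing_pair \<Omega> c R \<kappa> E y t A G"
proof -
  have op: "open \<Omega>" and bd: "bounded \<Omega>" and zero: "0 \<in> \<Omega>"
    using J by (auto simp: John_domain_def)
  have "\<exists>\<gamma> lam K. lam > 0 \<and> K > 0 \<and> (\<forall>y\<in>\<Omega>. \<gamma> 0 y = y \<and> \<gamma> 1 y = 0) \<and>
      (\<forall>y\<in>\<Omega>. \<forall>t\<in>{0..1}. bdist \<Omega> (\<gamma> t y) \<ge> lam * t) \<and>
      (\<forall>y\<in>\<Omega>. speed_bounded (\<lambda>t. \<gamma> t y) K)"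
    using J unfolding John_domain_def
    apply (elim conjE exE)
    subgoal for \<gamma> lam K C0 by (intro exI[of _ \<gamma>] exI[of _ lam] exI[of _ K]) simp
    done
  then obtain \<gamma> lam K where lam: "lam > 0" and K: "K > 0"
    and ends: "\<And>y. y \<in> \<Omega> \<Longrightarrow> \<gamma> 0 y = y \<and> \<gamma> 1 y = 0"
    and far: "\<And>y t. y \<in> \<Omega> \<Longrightarrow> t \<in> {0..1} \<Longrightarrow> bdist \<Omega> (\<gamma> t y) \<ge> lam * t"
    and sb: "\<And>y. y \<in> \<Omega> \<Longrightarrow> speed_bounded (\<lambda>t. \<gamma> t y) K"
    by metis
  define r where "r = lam / 16"
  define R where "R = K + lam"
  define V where "V = unit_ball_vol (DIM('a))"
  define c where "c = V * (lam / 32) ^ DIM('a) / 2"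
  define \<kappa> where "\<kappa> = (1 + R) + ((R + 1) * (3 / lam) + 1)"
  \<comment> \<open>With this \<open>\<eta>\<close> the curve moves by at most \<open>lam t / 16\<close> between the times \<open>\<rho> t\<close> and \<open>t\<close>; the two radii
     add at most \<open>lam t / 8\<close>, and \<open>3/16 lam t\<close> is less than half of \<open>15/32 lam t \<le> d(x)\<close>.\<close>
  define \<eta> where "\<eta> = min (1/2) (lam / (16 * K))"
  define \<rho> where "\<rho> = 1 - \<eta>"
  have V: "V > 0" unfolding V_def by simp
  have \<eta>: "0 < \<eta>" "\<eta> \<le> 1/2" "\<eta> * K \<le> lam / 16"
    using lam K by (auto simp: \<eta>_def min_def field_simps)
  have \<rho>: "1/2 \<le> \<rho>" "\<rho> < 1" using \<eta> by (auto simp: \<rho>_def)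
  have d0: "lam \<le> bdist \<Omega> 0" using far[OF zero, of 1] ends[OF zero] by simp
  have cb: "cball 0 r \<subseteq> \<Omega>"
  proof
    fix x assume "x \<in> cball (0::'a) r"
    then show "x \<in> \<Omega>"
      using ball_bdist_subset[OF op bd zero zero, of x] d0 lam by (simp add: r_def)
  qed
  have "\<exists>t A G. crossing_pair \<Omega> c R \<kappa> E y t A G"
    if E: "open E" "E \<subseteq> \<Omega>" "y \<in> E"
      and half: "measure lborel (E \<inter> ball 0 r) \<le> measure lborel (ball 0 r :: 'a set) / 2"
    for E and y :: 'a
  proof -
    have y: "y \<in> \<Omega>" using E by auto
    define g where "g = (\<lambda>t. \<gamma> t y)"
    have g01: "g 0 = y" "g 1 = 0" using ends[OF y] by (auto simp: g_def)
    have glip: "norm (g v - g u) \<le> K * (v - u)" if "0 \<le> u" "u \<le> v" "v \<le> 1" for u v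
      unfolding g_def by (rule speed_bounded_imp_norm_diff_le[OF sb[OF y] that])
    have gfar: "lam * t \<le> bdist \<Omega> (g t)" if "0 \<le> t" "t \<le> 1" for t
      using far[OF y, of t] that by (simp add: g_def)
    define B where "B = (\<lambda>t. ball (g t) (lam * t / 16))"
    have Bvol: "measure lborel (B t) = V * (lam * t / 16) ^ DIM('a)" if "0 \<le> t" for t
      unfolding B_def V_def using that lam by (subst content_ball) auto
    have By: "norm (x - y) < R * t" if "x \<in> B t" "0 < t" "t \<le> 1" for x t
    proof -
      have "norm (x - y) \<le> norm (x - g t) + norm (g t - g 0)"
        using norm_triangle_ineq[of "x - g t" "g t - y"] by (simp add: g01)
      moreover have "norm (x - g t) < lam * t / 16"
        using that by (simp add: B_def dist_norm norm_minus_commute)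
      moreover have "lam * t / 16 \<le> lam * t" using lam that by simp
      ultimately show ?thesis using glip[of 0 t] that by (simp add: R_def algebra_simps)
    qed
    have Bd: "15/16 * (lam * t) \<le> bdist \<Omega> x" if "x \<in> B t" "0 < t" "t \<le> 1" for x t
      using gfar[of t] that bdist_diff_le[of \<Omega> "g t" x] by (simp add: B_def)
    define P where "P = (\<lambda>j. measure lborel (E \<inter> B (\<rho> ^ j)) > measure lborel (B (\<rho> ^ j)) / 2)"
    have "\<not> P 0" using half by (simp add: P_def B_def g01 r_def)
    moreover have "\<exists>j. P j"
    proof -
      obtain e where e: "e > 0" "ball y e \<subseteq> E" using E by (meson openE)
      have "R > 0" using K lam by (simp add: R_def)
      obtain j where j: "\<rho> ^ j < e / R"
        using real_arch_pow_inv[of "e / R" \<rho>] e \<open>R > 0\<close> \<rho> by auto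
      have pj: "0 < \<rho> ^ j" "\<rho> ^ j \<le> 1" using \<rho> by (auto simp: power_le_one)
      have "B (\<rho> ^ j) \<subseteq> ball y e"
      proof
        fix x assume "x \<in> B (\<rho> ^ j)"
        then have "norm (x - y) < R * \<rho> ^ j" using By pj by blast
        also have "\<dots> < e" using j \<open>R > 0\<close> by (simp add: field_simps)
        finally show "x \<in> ball y e" by (simp add: dist_norm norm_minus_commute)
      qed
      then have "E \<inter> B (\<rho> ^ j) = B (\<rho> ^ j)" using e by auto
      moreover have "measure lborel (B (\<rho> ^ j)) > 0" using Bvol[of "\<rho> ^ j"] pj V lam by simp
      ultimately show ?thesis unfolding P_def by (intro exI[of _ j]) simp
    qed
    ultimately obtain j where j: "\<not> P j" "P (Suc j)"
      using nat_induct[of "\<lambda>j. \<not> P j"] by blast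
    define t where "t = \<rho> ^ j"
    have t: "0 < t" "t \<le> 1" using \<rho> by (auto simp: t_def power_le_one)
    have rt: "0 < \<rho> * t" "\<rho> * t \<le> t" "\<rho> * t \<le> 1" "t / 2 \<le> \<rho> * t"
    proof -
      show "0 < \<rho> * t" using \<rho> t by simp
      show *: "\<rho> * t \<le> t" using \<rho> t by (simp add: mult_left_le_one_le)
      show "\<rho> * t \<le> 1" using * t by linarith
      show "t / 2 \<le> \<rho> * t" using mult_right_mono[OF \<rho>(1), of t] t by simp
    qed
    define A where "A = E \<inter> B (\<rho> * t)"
    define G where "G = B t - E"
    have Bopen: "open (B u)" "bounded (B u)" for u by (auto simp: B_def)
    have sets: "A \<in> sets borel" "G \<in> sets borel" "bounded G"
      unfolding A_def G_def using E(1) Bopen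
      by (auto intro: bounded_subset[OF Bopen(2)])
    have mono: "c * t ^ DIM('a) \<le> measure lborel (B u) / 2" if "t / 2 \<le> u" for u
    proof -
      have "(lam * t / 32) ^ DIM('a) \<le> (lam * u / 16) ^ DIM('a)"
        using that lam t by (intro power_mono) auto
      then have "V * (lam * t / 32) ^ DIM('a) \<le> V * (lam * u / 16) ^ DIM('a)"
        using V by simp
      then show ?thesis using Bvol[of u] that t
        by (simp add: c_def power_mult_distrib power_divide)
    qed
    have mA: "c * t ^ DIM('a) \<le> measure lborel A"
      using j(2) mono[OF rt(4)] by (simp add: P_def A_def t_def)
    have "measure lborel G = measure lborel (B t) - measure lborel (E \<inter> B t)"
      unfolding G_def by (rule measure_diff_bounded) (use E Bopen in auto)
    then have mG: "c * t ^ DIM('a) \<le> measure lborel G"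
      using j(1) mono[of t] t by (simp add: P_def t_def)
    have xd: "15/32 * (lam * t) \<le> bdist \<Omega> x" if "x \<in> B t \<or> x \<in> B (\<rho> * t)" for x
    proof -
      have "15/16 * (lam * (\<rho> * t)) \<le> bdist \<Omega> x \<or> 15/16 * (lam * t) \<le> bdist \<Omega> x"
        using that Bd rt(1,3) t by blast
      moreover have "lam * (t / 2) \<le> lam * (\<rho> * t)" using rt(4) lam by simp
      moreover have "0 \<le> lam * t" using lam t by simp
      ultimately show ?thesis by linarith
    qed
    have xy: "norm (x - y) \<le> R * t" if "x \<in> B t \<or> x \<in> B (\<rho> * t)" for x
    proof -
      have "norm (x - y) < R * (\<rho> * t) \<or> norm (x - y) < R * t"
        using that By rt(1,3) t by blast
      moreover have "R * (\<rho> * t) \<le> R * t" using rt K lam by (simp add: R_def)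
      ultimately show ?thesis by linarith
    qed
    have close: "norm (x - z) \<le> 3/16 * (lam * t)" if "x \<in> A" "z \<in> G" for x z
    proof -
      have "norm (x - z) \<le> norm (x - g (\<rho> * t)) + norm (g t - g (\<rho> * t)) + norm (z - g t)"
        using norm_triangle_ineq4[of "x - g (\<rho> * t)" "(z - g t) + (g t - g (\<rho> * t))"]
          norm_triangle_ineq[of "z - g t" "g t - g (\<rho> * t)"] by simp
      moreover have "norm (x - g (\<rho> * t)) \<le> lam * (\<rho> * t) / 16" "norm (z - g t) \<le> lam * t / 16"
        using that by (auto simp: A_def G_def B_def dist_norm norm_minus_commute)
      moreover have "lam * (\<rho> * t) \<le> lam * t" using lam rt by simp
      moreover have "norm (g t - g (\<rho> * t)) \<le> lam * t / 16"
      proof -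
        have "norm (g t - g (\<rho> * t)) \<le> K * (t - \<rho> * t)" using glip rt t by auto
        also have "\<dots> = \<eta> * K * t" by (simp add: \<rho>_def algebra_simps)
        also have "\<dots> \<le> lam / 16 * t" using \<eta> t by (intro mult_right_mono) auto
        finally show ?thesis by simp
      qed
      ultimately show ?thesis by linarith
    qed
    have lt: "0 < lam * t" using lam t by simp
    have comp: "max (bdist \<Omega> y) t \<le> \<kappa> * bdist \<Omega> x \<and> bdist \<Omega> x \<le> \<kappa> * max (bdist \<Omega> y) t"
      if "x \<in> A \<union> G" for x
    proof -
      have x: "x \<in> B t \<or> x \<in> B (\<rho> * t)" using that by (auto simp: A_def G_def)
      define D where "D = max (bdist \<Omega> y) t"
      have D: "bdist \<Omega> y \<le> D" "t \<le> D" "D \<le> bdist \<Omega> y + t" using t by (auto simp: D_def)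
      have dxy: "\<bar>bdist \<Omega> x - bdist \<Omega> y\<bar> \<le> R * t"
        using bdist_diff_le[of \<Omega> x y] xy[OF x] by (simp add: dist_norm)
      have td: "t \<le> 3 / lam * bdist \<Omega> x" 
      proof -
        have "lam * t \<le> 3 * bdist \<Omega> x" using xd[OF x] bdist_nonneg[of \<Omega> x] by linarith
        then show ?thesis using lam by (simp add: field_simps)
      qed
      have R0: "R > 0" using K lam by (simp add: R_def)
      have "R * t \<le> R * D" using D R0 by simp
      then have "bdist \<Omega> x \<le> (1 + R) * D" using dxy D by (simp add: algebra_simps)
      moreover have "(1 + R) * D \<le> \<kappa> * D"
        by (rule mult_right_mono) (use K lam D t in \<open>auto simp: \<kappa>_def R_def\<close>)
      moreover have "D \<le> \<kappa> * bdist \<Omega> x"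
      proof -
        have "D \<le> (R + 1) * t + bdist \<Omega> x" using D dxy by (simp add: algebra_simps)
        also have "\<dots> \<le> (R + 1) * (3 / lam * bdist \<Omega> x) + bdist \<Omega> x"
          using td R0 by (intro add_right_mono mult_left_mono) auto
        also have "\<dots> = ((R + 1) * (3 / lam) + 1) * bdist \<Omega> x" by (simp add: algebra_simps)
        also have "\<dots> \<le> \<kappa> * bdist \<Omega> x"
          by (rule mult_right_mono) (use K lam in \<open>auto simp: \<kappa>_def R_def\<close>)
        finally show ?thesis .
      qed
      ultimately show ?thesis unfolding D_def by linarith
    qed
    have "\<forall>x\<in>A. \<forall>z\<in>G. norm (x - z) \<le> bdist \<Omega> x / 2 \<and> norm (x - z) \<le> R * t"
    proof (intro ballI)
      fix x z assume xz: "x \<in> A" "z \<in> G"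
      have "15/32 * (lam * t) \<le> bdist \<Omega> x" using xz xd by (auto simp: A_def)
      moreover have "lam * t \<le> R * t" using K lam t by (simp add: R_def)
      ultimately show "norm (x - z) \<le> bdist \<Omega> x / 2 \<and> norm (x - z) \<le> R * t"
        using close[OF xz] lt by linarith
    qed
    moreover have "A \<subseteq> E \<inter> ball y (R * t)"
    proof
      fix x assume "x \<in> A"
      then have "x \<in> E" "norm (x - y) < R * (\<rho> * t)" using By rt by (auto simp: A_def)
      moreover have "R * (\<rho> * t) \<le> R * t" using rt K lam by (simp add: R_def)
      ultimately show "x \<in> E \<inter> ball y (R * t)" by (simp add: dist_norm norm_minus_commute)
    qed
    moreover have "G \<inter> E = {}" by (auto simp: G_def)
    ultimately show ?thesis unfolding crossing_pair_def using t sets mA mG comp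
      by (intro exI[of _ t] exI[of _ A] exI[of _ G] conjI) auto
  qed
  moreover have "\<kappa> \<ge> 1"
    unfolding \<kappa>_def R_def using K lam by (simp add: add_nonneg_nonneg)
  ultimately show ?thesis
    using lam K V cb by (intro that[of r R c \<kappa>]) (auto simp: r_def R_def c_def)
qed

section \<open>Fractional perimeter and weighted volume\<close>

text \<open>
  The weight with which the double integral counts the pair \<open>(x,z)\<close>, extended by 0 to all pairs of points.
\<close>

definition frac_kernel :: "'a::euclidean_space set \<Rightarrow> real \<Rightarrow> real \<Rightarrow> 'a \<Rightarrow> 'a \<Rightarrow> real" where
  "frac_kernel \<Omega> s b x z =
    (if x \<in> \<Omega> \<and> norm (x - z) \<le> bdist \<Omega> x / 2
     then bdist2 \<Omega> x z powr b / norm (z - x) powr (real DIM('a) + s) else 0)"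

text \<open>
  Only pairs that leave \<open>E\<close> are counted. The kernel is not symmetric in \<open>x\<close> and \<open>z\<close>, but one direction
  suffices for the isoperimetric inequality, and it is the one produced by the positive part of
  \<open>f(x) - f(z)\<close> in the coarea formula.
\<close>

definition frac_perimeter :: "'a::euclidean_space set \<Rightarrow> real \<Rightarrow> real \<Rightarrow> 'a set \<Rightarrow> ennreal" where
  "frac_perimeter \<Omega> s b E =
    (\<integral>\<^sup>+x. (\<integral>\<^sup>+z. ennreal (frac_kernel \<Omega> s b x z) * indicator (- E) z \<partial>lborel) * indicator E x \<partial>lborel)"

definition dist_measure :: "'a::euclidean_space set \<Rightarrow> real \<Rightarrow> 'a measure" where
  "dist_measure \<Omega> a = density lborel (\<lambda>x. ennreal (bdist \<Omega> x powr a) * indicator \<Omega> x)"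

lemma frac_kernel_nonneg [simp]: "0 \<le> frac_kernel \<Omega> s b x z"
  by (simp add: frac_kernel_def)

lemma measurable_frac_kernel [measurable]:
  assumes [measurable]: "\<Omega> \<in> sets borel" "f \<in> borel_measurable M" "g \<in> borel_measurable M"
  shows "(\<lambda>p. frac_kernel \<Omega> s b (f p) (g p)) \<in> borel_measurable M"
  unfolding frac_kernel_def bdist2_def by measurable

lemma space_dist_measure [simp]: "space (dist_measure \<Omega> a) = UNIV"
  and sets_dist_measure [simp, measurable_cong]: "sets (dist_measure \<Omega> a) = sets borel"
  by (simp_all add: dist_measure_def)

lemma dist_measure_le:
  assumes "\<Omega> \<in> sets borel" "S \<in> sets borel" "\<And>x. x \<in> S \<inter> \<Omega> \<Longrightarrow> bdist \<Omega> x \<le> D" "0 \<le> a"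
  shows "emeasure (dist_measure \<Omega> a) S \<le> ennreal (D powr a) * emeasure lborel S"
proof -
  note [measurable] = assms(1,2)
  have "emeasure (dist_measure \<Omega> a) S
      = (\<integral>\<^sup>+x. ennreal (bdist \<Omega> x powr a) * indicator \<Omega> x * indicator S x \<partial>lborel)"
    unfolding dist_measure_def by (subst emeasure_density) auto
  also have "\<dots> \<le> (\<integral>\<^sup>+x. ennreal (D powr a) * indicator S x \<partial>lborel)"
    using assms(3,4) by (intro nn_integral_mono)
      (auto split: split_indicator intro!: ennreal_leI powr_mono2)
  also have "\<dots> = ennreal (D powr a) * emeasure lborel S"
    by (simp add: nn_integral_cmult_indicator)
  finally show ?thesis .
qed

lemma emeasure_UN_le_count_space:
  assumes [measurable]: "\<And>i. i \<in> I \<Longrightarrow> X i \<in> sets M" and [simp]: "countable I"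
  shows "emeasure M (\<Union>(X ` I)) \<le> (\<integral>\<^sup>+i. emeasure M (X i) \<partial>count_space I)"
proof -
  note sets.countable_UN'[unfolded subset_eq, measurable]
  have le: "indicator (\<Union>(X ` I)) x \<le> (\<integral>\<^sup>+ i. indicator (X i) x \<partial>count_space I)" for x
  proof (cases "x \<in> \<Union>(X ` I)")
    case True
    then obtain j where j: "j \<in> I" "x \<in> X j" by blast
    have "(1::ennreal) = (\<integral>\<^sup>+i. indicator {j} i \<partial>count_space I)"
      using j by simp
    also have "\<dots> \<le> (\<integral>\<^sup>+ i. indicator (X i) x \<partial>count_space I)"
      using j by (intro nn_integral_mono) (auto split: split_indicator)
    finally show ?thesis using True by simp
  qed simp
  have "emeasure M (\<Union>(X ` I)) = (\<integral>\<^sup>+x. indicator (\<Union>(X ` I)) x \<partial>M)" by simp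
  also have "\<dots> \<le> (\<integral>\<^sup>+x. \<integral>\<^sup>+i. indicator (X i) x \<partial>count_space I \<partial>M)"
    by (rule nn_integral_mono) (rule le)
  also have "\<dots> = (\<integral>\<^sup>+i. \<integral>\<^sup>+x. indicator (X i) x \<partial>M \<partial>count_space I)"
    by (rule nn_integral_count_space_nn_integral) auto
  also have "\<dots> = (\<integral>\<^sup>+i. emeasure M (X i) \<partial>count_space I)"
    by (simp cong: nn_integral_cong_simp)
  finally show ?thesis .
qed

text \<open>
  Comparability survives real powers of either sign.
\<close>

lemma powr_comparable:
  fixes D m \<kappa> b :: real
  assumes D: "0 < D" "1 \<le> \<kappa>" and m: "D \<le> \<kappa> * m" "m \<le> \<kappa> * D"
  shows "\<kappa> powr (- \<bar>b\<bar>) * D powr b \<le> m powr b"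
proof (cases "0 \<le> b")
  case True
  have "(D / \<kappa>) powr b \<le> m powr b"
    using D m True by (intro powr_mono2) (auto simp: field_simps)
  then show ?thesis using D True by (simp add: powr_divide powr_minus field_simps)
next
  case False
  have "0 < m" using D m by (smt (verit) mult_nonneg_nonpos)
  then have "(\<kappa> * D) powr b \<le> m powr b"
    using m False by (intro powr_mono2') auto
  then show ?thesis using D False by (simp add: powr_mult)
qed

text \<open>
  The hypotheses on \<open>q\<close> and \<open>b\<close> are used here, and mean exactly the following. With \<open>D\<close> standing for
  \<open>max {d(y), t}\<close>, the left side is the weighted volume of a ball of radius about \<open>t\<close> near \<open>y\<close>, and
  \<open>t\<^sup>n\<^sup>-\<^sup>s D\<^sup>b\<close> is the order of the perimeter that a crossing pair at scale \<open>t\<close> contributes.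
  The condition \<open>q \<le> n/(n-s)\<close> says that the exponent \<open>e = n/q - (n-s)\<close> of \<open>t\<close> left over is
  nonnegative, so that \<open>t\<close> may be replaced by \<open>D\<close>; the condition on \<open>b\<close> says that the exponent \<open>e'\<close> of
  \<open>D\<close> left over after this is nonnegative, so that \<open>D\<close> may be replaced by its upper bound \<open>M\<close>.
\<close>

lemma weighted_volume_le_energy_powr:
  fixes n :: nat and s q a b M :: real
  assumes "n \<ge> 1" "s < 1" and q: "1 \<le> q" "q \<le> real n / (real n - s)"
    and b: "b \<le> (real n + a) / q - real n + s" and "M > 0"
  obtains k where "k > 0"
    "\<And>t D. 0 < t \<Longrightarrow> t \<le> D \<Longrightarrow> D \<le> M \<Longrightarrow>
      t ^ n * D powr a \<le> (k * (t powr (real n - s) * D powr b)) powr q"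
proof -
  define e where "e = real n / q - (real n - s)"
  define e' where "e' = (real n + a) / q - real n + s - b"
  have ns: "real n - s > 0" using assms by linarith
  have e: "e \<ge> 0" using q ns by (simp add: e_def field_simps)
  have e': "e' \<ge> 0" using b by (simp add: e'_def)
  have main: "t ^ n * D powr a \<le> (M powr e' * (t powr (real n - s) * D powr b)) powr q"
    if t: "0 < t" "t \<le> D" "D \<le> M" for t D
  proof -
    have D: "0 < D" using t by simp
    have "t ^ n * D powr a = (t powr (real n / q) * D powr (a / q)) powr q"
      using t D q by (simp add: powr_mult powr_powr powr_realpow)
    also have "\<dots> \<le> (M powr e' * (t powr (real n - s) * D powr b)) powr q"
    proof (rule powr_mono2)
      have "t powr (real n / q) * D powr (a / q) = t powr (real n - s) * (t powr e * D powr (a / q))"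
        by (simp add: e_def powr_add[symmetric] flip: mult.assoc)
      also have "\<dots> \<le> t powr (real n - s) * (D powr e * D powr (a / q))"
        using t e by (intro mult_left_mono mult_right_mono powr_mono2) auto
      also have "D powr e * D powr (a / q) = D powr e' * D powr b"
        by (simp add: powr_add[symmetric] e_def e'_def add_divide_distrib algebra_simps)
      also have "t powr (real n - s) * (D powr e' * D powr b)
          \<le> t powr (real n - s) * (M powr e' * D powr b)"
        using t e' by (intro mult_left_mono mult_right_mono powr_mono2) auto
      finally show "t powr (real n / q) * D powr (a / q)
          \<le> M powr e' * (t powr (real n - s) * D powr b)" by (simp add: mult_ac)
    qed (use q in auto)
    finally show ?thesis .
  qed
  show ?thesis by (rule that[of "M powr e'"]) (use main \<open>M > 0\<close> in auto)
qed

lemma powr_mult_self_real: "0 \<le> x \<Longrightarrow> x powr (q - 1) * x = x powr q" for x q :: real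
  by (cases "x = 0") (simp_all add: powr_diff)

text \<open>
  If the local inequality holds in a ball around each point of \<open>E\<close>, the Vitali covering lemma selects
  disjoint balls whose fivefold enlargements cover \<open>E\<close>; the sets \<open>A\<close> in them are disjoint, so that the
  masses \<open>\<nu> A\<close> add up to at most the total mass.
\<close>

lemma vitali_energy_sum:
  fixes E :: "'a::euclidean_space set" and \<mu> \<nu> :: "'a measure"
  assumes sets: "sets \<mu> = sets borel" "sets \<nu> = sets borel"
    and q: "1 \<le> q" and C: "0 \<le> C" and fin: "emeasure \<nu> UNIV < \<infinity>"
    and E: "E \<in> sets borel"
    and loc: "\<And>y. y \<in> E \<Longrightarrow> \<exists>t A. 0 < t \<and> t \<le> T \<and> A \<in> sets borel \<and> A \<subseteq> ball y t \<and>
      emeasure \<mu> (ball y (5 * t)) \<le> ennreal ((C * enn2real (emeasure \<nu> A)) powr q)"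
  shows "emeasure \<mu> E \<le> ennreal ((C * enn2real (emeasure \<nu> UNIV)) powr q)"
proof -
  note [measurable_cong] = sets
  have space: "space \<mu> = UNIV" "space \<nu> = UNIV"
    using sets_eq_imp_space_eq[OF sets(1)] sets_eq_imp_space_eq[OF sets(2)] by auto
  define P where "P = enn2real (emeasure \<nu> UNIV)"
  obtain t A where tA: "\<And>y. y \<in> E \<Longrightarrow> 0 < t y \<and> t y \<le> T \<and> A y \<in> sets borel \<and> A y \<subseteq> ball y (t y) \<and>
      emeasure \<mu> (ball y (5 * t y)) \<le> ennreal ((C * enn2real (emeasure \<nu> (A y))) powr q)"
    using loc by metis
  have "E \<subseteq> (\<Union>y\<in>E. ball y (t y))" using tA by force
  then obtain I where I: "countable I" "I \<subseteq> E"
      "pairwise (\<lambda>i j. disjnt (ball i (t i)) (ball j (t j))) I"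
      "E \<subseteq> (\<Union>i\<in>I. ball i (5 * t i))"
    by (rule Vitali_covering_lemma_balls[of E "\<lambda>y. y" t E T]) (use tA in auto)
  have meas [measurable]: "A i \<in> sets borel" if "i \<in> I" for i using tA I that by auto
  have disj: "disjoint_family_on A I"
    using I(2,3) tA unfolding disjoint_family_on_def pairwise_def disjnt_def
    by (smt (verit, best) disjoint_iff subset_eq)
  \<comment> \<open>Since \<open>q \<ge> 1\<close> and no piece exceeds the total, the \<open>q\<close>-th powers are linearly controlled.\<close>
  have piece: "emeasure \<mu> (ball i (5 * t i)) \<le> ennreal ((C * P) powr (q - 1) * C) * emeasure \<nu> (A i)"
    if i: "i \<in> I" for i
  proof -
    define p where "p = enn2real (emeasure \<nu> (A i))"
    have le: "emeasure \<nu> (A i) \<le> emeasure \<nu> UNIV"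
      using space by (metis emeasure_space)
    then have fi: "emeasure \<nu> (A i) = ennreal p"
      using fin unfolding p_def by (simp add: less_top top_unique)
    have p: "0 \<le> p" "p \<le> P" using le fin unfolding p_def P_def by (auto intro: enn2real_mono)
    have "(C * p) powr q = (C * p) powr (q - 1) * (C * p)"
      using C p by (simp add: powr_mult_self_real)
    also have "\<dots> \<le> (C * P) powr (q - 1) * (C * p)"
      using C p q by (intro mult_right_mono powr_mono2 mult_left_mono) auto
    finally have "ennreal ((C * p) powr q) \<le> ennreal ((C * P) powr (q - 1) * C) * ennreal p"
      using C p by (simp add: ennreal_mult[symmetric] ennreal_leI mult_ac)
    then show ?thesis using tA[of i] I i fi unfolding p_def by fastforce
  qed
  have "emeasure \<mu> E \<le> emeasure \<mu> (\<Union>i\<in>I. ball i (5 * t i))"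
    using I by (intro emeasure_mono) auto
  also have "\<dots> \<le> (\<integral>\<^sup>+i. emeasure \<mu> (ball i (5 * t i)) \<partial>count_space I)"
    using I by (intro emeasure_UN_le_count_space) auto
  also have "\<dots> \<le> (\<integral>\<^sup>+i. ennreal ((C * P) powr (q - 1) * C) * emeasure \<nu> (A i) \<partial>count_space I)"
    using piece by (intro nn_integral_mono) auto
  also have "\<dots> = ennreal ((C * P) powr (q - 1) * C) * (\<integral>\<^sup>+i. emeasure \<nu> (A i) \<partial>count_space I)"
    by (rule nn_integral_cmult) auto
  also have "(\<integral>\<^sup>+i. emeasure \<nu> (A i) \<partial>count_space I) = emeasure \<nu> (\<Union>(A ` I))"
    using I disj by (intro emeasure_UN_countable[symmetric]) auto
  also have "\<dots> \<le> emeasure \<nu> UNIV"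
    using space by (metis emeasure_space)
  also have "emeasure \<nu> UNIV = ennreal P"
    using fin by (simp add: P_def less_top)
  also have "ennreal ((C * P) powr (q - 1) * C) * ennreal P = ennreal ((C * P) powr q)"
    using C by (simp add: ennreal_mult[symmetric] P_def mult.assoc powr_mult_self_real)
  finally show ?thesis by (simp add: P_def mult_left_mono)
qed

section \<open>The isoperimetric inequality in a John domain\<close>

text \<open>
  All pairs in \<open>A \<times> G\<close> contribute to the perimeter, each at least the smallest value of the kernel.
\<close>

lemma perimeter_density_lower_bound:
  fixes \<Omega> E A G :: "'a::euclidean_space set"
  assumes \<Omega> [measurable]: "\<Omega> \<in> sets borel" and E [measurable]: "E \<in> sets borel"
    and A [measurable]: "A \<in> sets borel" and G [measurable]: "G \<in> sets borel"
    and AE: "A \<subseteq> E" "A \<subseteq> \<Omega>" and GE: "G \<inter> E = {}" and "bounded A" "bounded G"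
    and L: "0 < L" and near: "\<And>x z. x \<in> A \<Longrightarrow> z \<in> G \<Longrightarrow> norm (x - z) \<le> bdist \<Omega> x / 2 \<and> norm (x - z) \<le> L"
    and w: "\<And>x z. x \<in> A \<Longrightarrow> z \<in> G \<Longrightarrow> w \<le> bdist2 \<Omega> x z powr b" "0 \<le> w"
    and s: "0 < s"
  shows "ennreal (measure lborel A * measure lborel G * (w / L powr (real DIM('a) + s)))
    \<le> (\<integral>\<^sup>+x. (\<integral>\<^sup>+z. ennreal (frac_kernel \<Omega> s b x z) * indicator (- E) z \<partial>lborel)
            * indicator E x * indicator A x \<partial>lborel)"
proof -
  define k where "k = w / L powr (real DIM('a) + s)"
  have k0: "0 \<le> k" using w by (simp add: k_def)
  have fin: "emeasure lborel A = ennreal (measure lborel A)"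
      "emeasure lborel G = ennreal (measure lborel G)"
    using emeasure_bounded_finite[of A] emeasure_bounded_finite[of G] assms
    by (auto simp: emeasure_eq_ennreal_measure less_top)
  have k: "k \<le> frac_kernel \<Omega> s b x z" if "x \<in> A" "z \<in> G" for x z
  proof -
    have "x \<noteq> z" using that AE GE by auto
    then have "norm (z - x) > 0" by simp
    moreover have "norm (z - x) \<le> L" using near[OF that] by (simp add: norm_minus_commute)
    ultimately have "k \<le> bdist2 \<Omega> x z powr b / norm (z - x) powr (real DIM('a) + s)"
      unfolding k_def using w(1)[OF that] w(2) s L
      by (intro frac_le powr_mono2) auto
    then show ?thesis using that AE near[OF that] by (auto simp: frac_kernel_def)
  qed
  have "ennreal (measure lborel A * measure lborel G * k)
      = (\<integral>\<^sup>+x. (\<integral>\<^sup>+z. ennreal k * indicator G z \<partial>lborel) * indicator A x \<partial>lborel)"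
    unfolding nn_integral_cmult_indicator[OF sets_lborel[THEN equalityD2, THEN subsetD, OF G]]
      nn_integral_cmult_indicator[OF sets_lborel[THEN equalityD2, THEN subsetD, OF A]]
    using k0 by (simp add: fin ennreal_mult mult_ac)
  also have "\<dots> \<le> (\<integral>\<^sup>+x. (\<integral>\<^sup>+z. ennreal (frac_kernel \<Omega> s b x z) * indicator (- E) z \<partial>lborel)
            * indicator E x * indicator A x \<partial>lborel)"
  proof (rule nn_integral_mono)
    fix x
    show "(\<integral>\<^sup>+z. ennreal k * indicator G z \<partial>lborel) * indicator A x
      \<le> (\<integral>\<^sup>+z. ennreal (frac_kernel \<Omega> s b x z) * indicator (- E) z \<partial>lborel)
            * indicator E x * indicator A x"
    proof (cases "x \<in> A")
      case True
      have "(\<integral>\<^sup>+z. ennreal k * indicator G z \<partial>lborel)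
          \<le> (\<integral>\<^sup>+z. ennreal (frac_kernel \<Omega> s b x z) * indicator (- E) z \<partial>lborel)"
        using k[OF True] GE by (intro nn_integral_mono) (auto split: split_indicator intro!: ennreal_leI)
      then show ?thesis using True AE by auto
    qed simp
  qed
  finally show ?thesis by (simp add: k_def)
qed

text \<open>
  Every point of \<open>E\<close> is the centre of a ball that carries a crossing pair. There the scales \<open>t\<close> and
  \<open>D = max {d(y), t}\<close> determine both sides up to constants: the weighted volume of the ball is at most of
  order \<open>t\<^sup>n D\<^sup>a\<close>, and the perimeter contributed by the pair is at least of order
  \<open>t\<^sup>2\<^sup>n t\<^sup>-\<^sup>n\<^sup>-\<^sup>s D\<^sup>b\<close>. The Vitali argument turns this into a global inequality.
\<close>

theorem John_fractional_isoperimetric: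
  fixes \<Omega> :: "'a::euclidean_space set" and s q a b :: real
  assumes J: "John_domain \<Omega>" and s: "0 < s" "s < 1"
    and q: "1 \<le> q" "q \<le> real DIM('a) / (real DIM('a) - s)" and a: "a \<ge> 0"
    and b: "b \<le> (real DIM('a) + a) / q - real DIM('a) + s"
  obtains r C :: real where "r > 0" "C > 0" "cball 0 r \<subseteq> \<Omega>"
    "\<And>E. open E \<Longrightarrow> E \<subseteq> \<Omega> \<Longrightarrow>
      measure lborel (E \<inter> ball 0 r) \<le> measure lborel (ball 0 r :: 'a set) / 2 \<Longrightarrow>
      frac_perimeter \<Omega> s b E < \<infinity> \<Longrightarrow>
      emeasure (dist_measure \<Omega> a) E \<le> ennreal ((C * enn2real (frac_perimeter \<Omega> s b E)) powr q)"
proof -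
  have op: "open \<Omega>" and bd: "bounded \<Omega>" and zero: "0 \<in> \<Omega>"
    using J by (auto simp: John_domain_def)
  have \<Omega> [measurable]: "\<Omega> \<in> sets borel" using op by simp
  define n where "n = DIM('a)"
  have n: "n \<ge> 1" by (simp add: n_def Suc_leI)
  obtain r R c \<kappa> where r: "r > 0" and R: "R > 0" and c: "c > 0" and \<kappa>: "\<kappa> \<ge> 1"
    and sub: "cball 0 r \<subseteq> \<Omega>"
    and crossing: "\<And>E y. open E \<Longrightarrow> E \<subseteq> \<Omega> \<Longrightarrow> y \<in> E \<Longrightarrow>
      measure lborel (E \<inter> ball 0 r) \<le> measure lborel (ball 0 r :: 'a set) / 2 \<Longrightarrow>
      \<exists>t A G. crossing_pair \<Omega> c R \<kappa> E y t A G"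
    by (rule John_domain_crossing[OF J]) blast
  obtain M0 where M0: "M0 > 0" "\<And>x. x \<in> \<Omega> \<Longrightarrow> bdist \<Omega> x \<le> M0"
    using bdist_bounded[OF op bd zero] by blast
  define M where "M = max M0 1"
  obtain k where k: "k > 0" "\<And>t D. 0 < t \<Longrightarrow> t \<le> D \<Longrightarrow> D \<le> M \<Longrightarrow>
      t ^ n * D powr a \<le> (k * (t powr (real n - s) * D powr b)) powr q"
  proof (rule weighted_volume_le_energy_powr[OF n s(2) q(1)])
    show "q \<le> real n / (real n - s)" using q(2) by (simp add: n_def)
    show "b \<le> (real n + a) / q - real n + s" using b by (simp add: n_def)
    show "M > 0" by (simp add: M_def)
  qed (use that in blast)
  define c1 where "c1 = c * c * \<kappa> powr (- \<bar>b\<bar>) / R powr (real n + s)"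
  define C2 where "C2 = unit_ball_vol n * (5 * R) ^ n * (1 + 5 * R) powr a"
  define C where "C = C2 powr (1 / q) * (k / c1)"
  have c1: "c1 > 0" using c \<kappa> R by (simp add: c1_def)
  have C2: "C2 > 0" using R by (simp add: C2_def)
  have C: "C > 0" using C2 k c1 by (simp add: C_def)
  have "emeasure (dist_measure \<Omega> a) E \<le> ennreal ((C * enn2real (frac_perimeter \<Omega> s b E)) powr q)"
    if E: "open E" "E \<subseteq> \<Omega>"
      and half: "measure lborel (E \<inter> ball 0 r) \<le> measure lborel (ball 0 r :: 'a set) / 2"
      and fin: "frac_perimeter \<Omega> s b E < \<infinity>" for E
  proof -
    have Em [measurable]: "E \<in> sets borel" using E by simp
    define \<nu> where "\<nu> = density lborel (\<lambda>x.
      (\<integral>\<^sup>+z. ennreal (frac_kernel \<Omega> s b x z) * indicator (- E) z \<partial>lborel) * indicator E x)"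
    have meas [measurable]: "(\<lambda>x. (\<integral>\<^sup>+z. ennreal (frac_kernel \<Omega> s b x z) * indicator (- E) z \<partial>lborel)
        * indicator E x) \<in> borel_measurable lborel" by measurable
    have \<nu>: "emeasure \<nu> A = (\<integral>\<^sup>+x. (\<integral>\<^sup>+z. ennreal (frac_kernel \<Omega> s b x z) * indicator (- E) z \<partial>lborel)
        * indicator E x * indicator A x \<partial>lborel)" if "A \<in> sets borel" for A
      unfolding \<nu>_def by (subst emeasure_density) (use that in auto)
    have P: "emeasure \<nu> UNIV = frac_perimeter \<Omega> s b E"
      by (simp add: \<nu> frac_perimeter_def)
    have "emeasure (dist_measure \<Omega> a) E \<le> ennreal ((C * enn2real (emeasure \<nu> UNIV)) powr q)"
    proof (rule vitali_energy_sum[where T = R])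
      fix y assume y: "y \<in> E"
      obtain t A G where pair: "crossing_pair \<Omega> c R \<kappa> E y t A G"
        using crossing[OF E y half] by blast
      have t: "0 < t" "t \<le> 1" and AG: "A \<in> sets borel" "G \<in> sets borel"
        "A \<subseteq> E \<inter> ball y (R * t)" "G \<inter> E = {}" "bounded G"
        "c * t ^ n \<le> measure lborel A" "c * t ^ n \<le> measure lborel G"
        and near: "\<And>x z. x \<in> A \<Longrightarrow> z \<in> G \<Longrightarrow> norm (x - z) \<le> bdist \<Omega> x / 2 \<and> norm (x - z) \<le> R * t"
        and comp: "\<And>x. x \<in> A \<union> G \<Longrightarrow> max (bdist \<Omega> y) t \<le> \<kappa> * bdist \<Omega> x \<and>
          bdist \<Omega> x \<le> \<kappa> * max (bdist \<Omega> y) t"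
        using pair unfolding crossing_pair_def n_def by simp_all
      define D where "D = max (bdist \<Omega> y) t"
      have "bdist \<Omega> y \<le> M0" using M0 y E by auto
      then have D: "0 < D" "t \<le> D" "D \<le> M" "bdist \<Omega> y \<le> D"
        using t by (auto simp: D_def M_def)
      define p where "p = enn2real (emeasure \<nu> A)"
      have "emeasure \<nu> A \<le> emeasure \<nu> UNIV"
        by (rule emeasure_mono) (auto simp: \<nu>_def)
      then have p: "emeasure \<nu> A = ennreal p"
        using fin P unfolding p_def by (simp add: less_top top_unique)
      have p0: "0 \<le> p" by (simp add: p_def)
      have en: "c1 * (t powr (real n - s) * D powr b) \<le> p"
      proof -
        define w where "w = \<kappa> powr (- \<bar>b\<bar>) * D powr b"
        have w: "w \<le> bdist2 \<Omega> x z powr b" if "x \<in> A" "z \<in> G" for x z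
          unfolding w_def
          by (rule powr_comparable)
             (use D \<kappa> comp[of x] comp[of z] that in \<open>auto simp: D_def[symmetric] bdist2_def min_def\<close>)
        have "ennreal (measure lborel A * measure lborel G * (w / (R * t) powr (real n + s)))
            \<le> emeasure \<nu> A"
          unfolding \<nu>[OF AG(1)] n_def
          by (rule perimeter_density_lower_bound)
             (use AG E near w R t s \<open>E \<in> sets borel\<close> \<Omega> in
              \<open>auto simp: w_def intro: bounded_subset[of "ball y (R * t)"]\<close>)
        then have 1: "measure lborel A * measure lborel G * (w / (R * t) powr (real n + s)) \<le> p"
          using p p0 by simp
        have w0: "0 \<le> w / (R * t) powr (real n + s)" by (simp add: w_def)
        have "(c * t ^ n) * (c * t ^ n) \<le> measure lborel A * measure lborel G"
          using AG c t by (intro mult_mono) auto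
        then have "(c * t ^ n) * (c * t ^ n) * (w / (R * t) powr (real n + s)) \<le> p"
          using mult_right_mono[OF _ w0] 1 by fastforce
        moreover have "(c * t ^ n) * (c * t ^ n) * (w / (R * t) powr (real n + s))
            = c1 * (t powr (real n - s) * D powr b)"
        proof -
          have "t ^ n * t ^ n / t powr (real n + s) = t powr (real n - s)"
            using t by (simp add: powr_realpow[symmetric] powr_add[symmetric] powr_diff[symmetric])
          then show ?thesis
            using t R by (simp add: c1_def w_def powr_mult field_simps)
        qed
        ultimately show ?thesis by simp
      qed
      have "emeasure (dist_measure \<Omega> a) (ball y (5 * (R * t)))
          \<le> ennreal (((1 + 5 * R) * D) powr a) * emeasure lborel (ball y (5 * (R * t)))"
      proof (rule dist_measure_le)
        fix x assume "x \<in> ball y (5 * (R * t)) \<inter> \<Omega>"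
        then have "bdist \<Omega> x \<le> D + 5 * (R * t)"
          using bdist_diff_le[of \<Omega> y x] D by (auto simp: abs_le_iff)
        moreover have "R * t \<le> R * D" using R D by simp
        ultimately show "bdist \<Omega> x \<le> (1 + 5 * R) * D" by (simp add: algebra_simps)
      qed (use a in auto)
      also have "\<dots> = ennreal (C2 * (t ^ n * D powr a))"
      proof -
        have "emeasure lborel (ball y (5 * (R * t))) = ennreal (unit_ball_vol n * (5 * (R * t)) ^ n)"
          using R t unfolding n_def by (subst emeasure_ball) auto
        then show ?thesis using R t D
          by (simp add: ennreal_mult[symmetric] C2_def powr_mult power_mult_distrib mult_ac)
      qed
      also have "\<dots> \<le> ennreal ((C * p) powr q)"
      proof (rule ennreal_leI)
        have "C2 * (t ^ n * D powr a) \<le> C2 * (k * (t powr (real n - s) * D powr b)) powr q"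
          using C2 k(2) t D by (intro mult_left_mono) auto
        also have "\<dots> \<le> C2 * (k / c1 * p) powr q"
        proof (intro mult_left_mono powr_mono2)
          have "t powr (real n - s) * D powr b \<le> p / c1"
            using en c1 by (simp add: field_simps)
          from mult_left_mono[OF this, of k] k(1)
          show "k * (t powr (real n - s) * D powr b) \<le> k / c1 * p" by simp
        qed (use C2 k q in auto)
        also have "\<dots> = (C * p) powr q"
        proof -
          have "C2 = (C2 powr (1 / q)) powr q" using C2 q by (simp add: powr_powr)
          then show ?thesis using C2 k c1 p0
            by (simp add: C_def powr_mult powr_divide)
        qed
        finally show "C2 * (t ^ n * D powr a) \<le> (C * p) powr q" .
      qed
      finally have "emeasure (dist_measure \<Omega> a) (ball y (5 * (R * t))) \<le> ennreal ((C * p) powr q)" .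
      then show "\<exists>t A. 0 < t \<and> t \<le> R \<and> A \<in> sets borel \<and> A \<subseteq> ball y t \<and>
          emeasure (dist_measure \<Omega> a) (ball y (5 * t)) \<le> ennreal ((C * enn2real (emeasure \<nu> A)) powr q)"
        using t R AG unfolding p_def by (intro exI[of _ "R * t"] exI[of _ A]) auto
    qed (use q C fin P Em in \<open>auto simp: \<nu>_def\<close>)
    then show ?thesis by (simp add: P)
  qed
  then show ?thesis using that[OF r C sub] by blast
qed

section \<open>From level sets to functions\<close>

lemma open_superlevel:
  fixes f :: "'a::topological_space \<Rightarrow> real"
  assumes "continuous_on S f" "open S"
  shows "open {x \<in> S. t < f x}" "open {x \<in> S. f x < t}"
proof -
  have "{x \<in> S. t < f x} = S \<inter> f -` {t<..}" "{x \<in> S. f x < t} = S \<inter> f -` {..<t}" by auto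
  then show "open {x \<in> S. t < f x}" "open {x \<in> S. f x < t}"
    using continuous_open_preimage[OF assms open_greaterThan]
      continuous_open_preimage[OF assms open_lessThan] by simp_all
qed

lemma measure_lborel_mono:
  fixes S S' :: "'a::euclidean_space set"
  assumes "S \<subseteq> S'" "S \<in> sets borel" "S' \<in> sets borel" "bounded S'"
  shows "measure lborel S \<le> measure lborel S'"
  using assms emeasure_bounded_finite[OF assms(4)]
  by (intro measure_mono_fmeasurable fmeasurableI) auto

lemma powr_eq_nn_integral_deriv:
  fixes y q :: real
  assumes "0 \<le> y" "1 \<le> q"
  shows "ennreal (y powr q) = (\<integral>\<^sup>+t. ennreal (q * t powr (q - 1)) * indicator {0<..<y} t \<partial>lborel)"
proof -
  have "((\<lambda>t. q * t powr (q - 1)) has_integral (y powr q - 0 powr q)) {0..y}"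
  proof (rule fundamental_theorem_of_calculus_interior)
    show "continuous_on {0..y} (\<lambda>t. t powr q)"
      using assms by (intro continuous_on_powr' continuous_intros) auto
    show "((\<lambda>t. t powr q) has_vector_derivative q * x powr (q - 1)) (at x)" if "x \<in> {0<..<y}" for x
      using that has_real_derivative_powr[of x q]
      by (simp add: has_real_derivative_iff_has_vector_derivative)
  qed (use assms in auto)
  then have "((\<lambda>t. q * t powr (q - 1)) has_integral y powr q) {0<..<y}"
    by (simp add: has_integral_Icc_iff_Ioo)
  moreover have "(\<lambda>t. if t \<in> {0<..<y} then q * t powr (q - 1) else 0)
      = (\<lambda>t. indicator {0<..<y} t * (q * t powr (q - 1)))" by (auto simp: fun_eq_iff)
  ultimately have "((\<lambda>t. indicator {0<..<y} t * (q * t powr (q - 1))) has_integral y powr q) UNIV"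
    using has_integral_restrict_UNIV[of "{0<..<y}" "\<lambda>t. q * t powr (q - 1)"] by simp
  then have "(\<integral>\<^sup>+t. ennreal (indicator {0<..<y} t * (q * t powr (q - 1))) \<partial>lborel) = ennreal (y powr q)"
    using assms by (intro nn_integral_has_integral_lborel) auto
  then show ?thesis
    by (metis (no_types, lifting) indicator_mult_ennreal mult.commute nn_integral_cong)
qed

text \<open>
  A substitute for Minkowski's integral inequality in the layer cake formula
  \<open>\<integral> g\<^sup>q d\<mu> = \<integral> q t\<^sup>q\<^sup>-\<^sup>1 \<mu>{g > t} dt\<close>. Put \<open>v(t) = \<mu>{g > t}\<^sup>1\<^sup>/\<^sup>q\<close>. Since \<open>v\<close> is
  decreasing and bounded by \<open>P\<close>, we have \<open>t v(t) \<le> \<integral> P \<le> N\<close>, so the integrand \<open>q (t v)\<^sup>q\<^sup>-\<^sup>1 v\<close> is at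
  most \<open>q N\<^sup>q\<^sup>-\<^sup>1 P(t)\<close>, and its integral at most \<open>q N\<^sup>q\<close>.
\<close>

lemma nn_integral_powr_le_of_level_sets:
  fixes g :: "'a \<Rightarrow> real" and P :: "real \<Rightarrow> ennreal"
  assumes sf: "sigma_finite_measure \<mu>" and g [measurable]: "g \<in> borel_measurable \<mu>"
    and g0: "\<And>x. 0 \<le> g x" and q: "1 \<le> q" and N: "0 \<le> N"
    and P [measurable]: "P \<in> borel_measurable borel"
    and PN: "(\<integral>\<^sup>+t. P t \<partial>lborel) \<le> ennreal N"
    and level: "\<And>t. 0 < t \<Longrightarrow> P t < \<infinity> \<Longrightarrow>
      emeasure \<mu> {x \<in> space \<mu>. t < g x} \<le> ennreal (enn2real (P t) powr q)"
  shows "(\<integral>\<^sup>+x. ennreal (g x powr q) \<partial>\<mu>) \<le> ennreal (q * N powr q)"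
proof -
  interpret \<mu>: sigma_finite_measure \<mu> by (rule sf)
  interpret pair_sigma_finite lborel \<mu> ..
  have key: "ennreal (q * t powr (q - 1)) * indicator {0<..} t * emeasure \<mu> {x \<in> space \<mu>. t < g x}
      \<le> ennreal (q * N powr (q - 1)) * P t" if Pt: "P t < \<infinity>" for t
  proof (cases "0 < t")
    case True
    define U where "U = emeasure \<mu> {x \<in> space \<mu>. t < g x}"
    define v where "v = enn2real U powr (1 / q)"
    have v0: "0 \<le> v" by (simp add: v_def)
    have "U < \<infinity>"
      using level[OF True Pt] unfolding U_def by (metis ennreal_less_top infinity_ennreal_def order_le_less_trans)
    then have U: "U = ennreal (v powr q)"
      using q by (simp add: v_def powr_powr less_top)
    have vP: "ennreal v \<le> P \<sigma>" if "0 < \<sigma>" "\<sigma> \<le> t" for \<sigma>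
    proof (cases "P \<sigma> < \<infinity>")
      case True
      have "U \<le> emeasure \<mu> {x \<in> space \<mu>. \<sigma> < g x}"
        unfolding U_def using that by (intro emeasure_mono) auto
      also have "\<dots> \<le> ennreal (enn2real (P \<sigma>) powr q)" by (rule level[OF that(1) True])
      finally have "v powr q \<le> enn2real (P \<sigma>) powr q" by (simp add: U)
      then have "v \<le> enn2real (P \<sigma>)"
        using q v0 by (meson enn2real_nonneg not_le powr_less_mono2 zero_less_one order_less_le_trans)
      then have "ennreal v \<le> ennreal (enn2real (P \<sigma>))" by (rule ennreal_leI)
      also have "\<dots> = P \<sigma>" using True by (intro ennreal_enn2real) simp
      finally show ?thesis .
    qed (simp add: not_less top_unique)
    have "ennreal (t * v) = (\<integral>\<^sup>+\<sigma>. ennreal v * indicator {0<..t} \<sigma> \<partial>lborel)"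
      using True v0 by (simp add: nn_integral_cmult_indicator ennreal_mult' mult.commute)
    also have "\<dots> \<le> (\<integral>\<^sup>+\<sigma>. P \<sigma> \<partial>lborel)"
      using vP by (intro nn_integral_mono) (auto split: split_indicator)
    also have "\<dots> \<le> ennreal N" by (rule PN)
    finally have tv: "t * v \<le> N" using N by simp
    have "q * t powr (q - 1) * v powr q = q * ((t * v) powr (q - 1) * v)"
      using True v0 by (simp add: powr_mult powr_mult_self_real)
    also have "\<dots> \<le> q * (N powr (q - 1) * v)"
      using True v0 tv q by (intro mult_left_mono mult_right_mono powr_mono2) auto
    finally have "ennreal (q * t powr (q - 1)) * U \<le> ennreal (q * N powr (q - 1)) * ennreal v"
      using q v0 unfolding U by (simp add: ennreal_mult[symmetric] mult_ac)
    also have "\<dots> \<le> ennreal (q * N powr (q - 1)) * P t"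
      using vP[of t] True by (intro mult_left_mono) auto
    finally show ?thesis using True by (simp add: U_def)
  qed simp
  have "(\<integral>\<^sup>+t. P t \<partial>lborel) \<noteq> \<infinity>" using PN by (metis ennreal_neq_top infinity_ennreal_def top_unique)
  then have AE: "AE t in lborel. P t < \<infinity>"
    using nn_integral_PInf_AE[of P lborel] by (simp add: less_top)
  have "(\<integral>\<^sup>+x. ennreal (g x powr q) \<partial>\<mu>)
      = (\<integral>\<^sup>+x. (\<integral>\<^sup>+t. ennreal (q * t powr (q - 1)) * indicator {0<..<g x} t \<partial>lborel) \<partial>\<mu>)"
    by (simp add: powr_eq_nn_integral_deriv[OF g0 q])
  also have "\<dots> = (\<integral>\<^sup>+x. (\<integral>\<^sup>+t. ennreal (q * t powr (q - 1)) * (indicator {0<..} t *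
      indicator {x. fst x < g (snd x)} (t, x)) \<partial>lborel) \<partial>\<mu>)"
    by (intro nn_integral_cong) (auto split: split_indicator)
  also have "\<dots> = (\<integral>\<^sup>+t. (\<integral>\<^sup>+x. ennreal (q * t powr (q - 1)) * (indicator {0<..} t *
      indicator {x. fst x < g (snd x)} (t, x)) \<partial>\<mu>) \<partial>lborel)"
    by (rule Fubini') measurable
  also have "\<dots> = (\<integral>\<^sup>+t. ennreal (q * t powr (q - 1)) * indicator {0<..} t *
      emeasure \<mu> {x \<in> space \<mu>. t < g x} \<partial>lborel)"
  proof (rule nn_integral_cong)
    fix t :: real
    have "(\<integral>\<^sup>+x. ennreal (q * t powr (q - 1)) * (indicator {0<..} t *
        indicator {x. fst x < g (snd x)} (t, x)) \<partial>\<mu>)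
      = (\<integral>\<^sup>+x. ennreal (q * t powr (q - 1)) * indicator {0<..} t *
        indicator {x \<in> space \<mu>. t < g x} x \<partial>\<mu>)"
      by (intro nn_integral_cong) (auto split: split_indicator)
    also have "\<dots> = ennreal (q * t powr (q - 1)) * indicator {0<..} t *
      emeasure \<mu> {x \<in> space \<mu>. t < g x}"
      by (rule nn_integral_cmult_indicator) measurable
    finally show "(\<integral>\<^sup>+x. ennreal (q * t powr (q - 1)) * (indicator {0<..} t *
        indicator {x. fst x < g (snd x)} (t, x)) \<partial>\<mu>) = ennreal (q * t powr (q - 1)) * indicator {0<..} t *
      emeasure \<mu> {x \<in> space \<mu>. t < g x}" .
  qed
  also have "\<dots> \<le> (\<integral>\<^sup>+t. ennreal (q * N powr (q - 1)) * P t \<partial>lborel)"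
    by (rule nn_integral_mono_AE, use AE in eventually_elim, rule key)
  also have "\<dots> = ennreal (q * N powr (q - 1)) * (\<integral>\<^sup>+t. P t \<partial>lborel)"
    by (rule nn_integral_cmult) simp
  also have "\<dots> \<le> ennreal (q * N powr (q - 1)) * ennreal N"
    by (rule mult_left_mono[OF PN]) simp
  also have "\<dots> = ennreal (q * N powr q)"
    using q N by (simp add: ennreal_mult[symmetric] mult.assoc powr_mult_self_real)
  finally show ?thesis .
qed

section \<open>A coarea inequality for the double integral\<close>

definition frac_energy :: "'a::euclidean_space set \<Rightarrow> real \<Rightarrow> real \<Rightarrow> ('a \<Rightarrow> real) \<Rightarrow> ennreal" where
  "frac_energy \<Omega> s b f =
    (\<integral>\<^sup>+x\<in>\<Omega>. (\<integral>\<^sup>+z\<in>{z. norm (x - z) \<le> bdist \<Omega> x / 2}.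
        ennreal (\<bar>f z - f x\<bar> / norm (z - x) powr (real DIM('a) + s) * bdist2 \<Omega> x z powr b)
      \<partial>lborel) \<partial>lborel)"

lemma frac_energy_altdef:
  "frac_energy \<Omega> s b f = (\<integral>\<^sup>+x. (\<integral>\<^sup>+z. ennreal (frac_kernel \<Omega> s b x z * \<bar>f z - f x\<bar>) \<partial>lborel) \<partial>lborel)"
  unfolding frac_energy_def
proof (rule nn_integral_cong)
  fix x :: 'a
  show "(\<integral>\<^sup>+z\<in>{z. norm (x - z) \<le> bdist \<Omega> x / 2}.
        ennreal (\<bar>f z - f x\<bar> / norm (z - x) powr (real DIM('a) + s) * bdist2 \<Omega> x z powr b)
      \<partial>lborel) * indicator \<Omega> x = (\<integral>\<^sup>+z. ennreal (frac_kernel \<Omega> s b x z * \<bar>f z - f x\<bar>) \<partial>lborel)"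
  proof (cases "x \<in> \<Omega>")
    case True
    then show ?thesis
      by (auto intro!: nn_integral_cong simp: frac_kernel_def mult_ac split: split_indicator)
  qed (simp add: frac_kernel_def)
qed

definition zero_ext :: "'a set \<Rightarrow> ('a \<Rightarrow> real) \<Rightarrow> 'a \<Rightarrow> real" where
  "zero_ext \<Omega> u x = (if x \<in> \<Omega> then u x else 0)"

text \<open>
  The perimeter of the set \<open>{u > t}\<close>, in a form that is visibly measurable in \<open>t\<close>: a pair \<open>(x,z)\<close> leaves
  this set iff \<open>u z \<le> t < u x\<close>.
\<close>

definition level_perimeter ::
    "'a::euclidean_space set \<Rightarrow> real \<Rightarrow> real \<Rightarrow> ('a \<Rightarrow> real) \<Rightarrow> real \<Rightarrow> ennreal" where
  "level_perimeter \<Omega> s b u t = (\<integral>\<^sup>+x. (\<integral>\<^sup>+z. ennreal (frac_kernel \<Omega> s b x z) *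
    indicator {zero_ext \<Omega> u z..<zero_ext \<Omega> u x} t \<partial>lborel) \<partial>lborel)"

context
  fixes \<Omega> :: "'a::euclidean_space set" and s b :: real and u :: "'a \<Rightarrow> real"
  assumes op: "open \<Omega>" and bd: "bounded \<Omega>" and zero: "0 \<in> \<Omega>" and u: "continuous_on \<Omega> u"
begin

lemma frac_kernel_nonzero_in:
  assumes "frac_kernel \<Omega> s b x z \<noteq> 0" shows "x \<in> \<Omega>" "z \<in> \<Omega>"
proof -
  from assms show x: "x \<in> \<Omega>" by (auto simp: frac_kernel_def split: if_splits)
  have "norm (x - z) \<le> bdist \<Omega> x / 2" using assms by (auto simp: frac_kernel_def split: if_splits)
  then show "z \<in> \<Omega>"
    using bdist_pos[OF op bd zero x] by (intro ball_bdist_subset[OF op bd zero x]) (auto simp: dist_norm)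
qed

lemma measurable_zero_ext [measurable]: "zero_ext \<Omega> u \<in> borel_measurable borel"
proof -
  have "(\<lambda>x. indicator \<Omega> x *\<^sub>R u x) \<in> borel_measurable borel"
    using op by (intro borel_measurable_continuous_on_indicator u) auto
  moreover have "zero_ext \<Omega> u = (\<lambda>x. indicator \<Omega> x *\<^sub>R u x)"
    by (auto simp: zero_ext_def fun_eq_iff)
  ultimately show ?thesis by simp
qed

lemma frac_perimeter_superlevel:
  "frac_perimeter \<Omega> s b {x \<in> \<Omega>. t < u x} = level_perimeter \<Omega> s b u t"
  unfolding frac_perimeter_def level_perimeter_def
proof (rule nn_integral_cong)
  fix x :: 'a
  have eq: "ennreal (frac_kernel \<Omega> s b x z) * indicator (- {x \<in> \<Omega>. t < u x}) z * indicator {x \<in> \<Omega>. t < u x} x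
      = ennreal (frac_kernel \<Omega> s b x z) * indicator {zero_ext \<Omega> u z..<zero_ext \<Omega> u x} t" for z
    using frac_kernel_nonzero_in[of x z]
    by (cases "frac_kernel \<Omega> s b x z = 0") (auto simp: zero_ext_def split: split_indicator)
  have "(\<integral>\<^sup>+z. ennreal (frac_kernel \<Omega> s b x z) * indicator (- {x \<in> \<Omega>. t < u x}) z \<partial>lborel)
        * indicator {x \<in> \<Omega>. t < u x} x
      = (\<integral>\<^sup>+z. ennreal (frac_kernel \<Omega> s b x z) * indicator (- {x \<in> \<Omega>. t < u x}) z
        * indicator {x \<in> \<Omega>. t < u x} x \<partial>lborel)"
    by (cases "x \<in> {x \<in> \<Omega>. t < u x}") auto
  then show "(\<integral>\<^sup>+z. ennreal (frac_kernel \<Omega> s b x z) * indicator (- {x \<in> \<Omega>. t < u x}) z \<partial>lborel)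
        * indicator {x \<in> \<Omega>. t < u x} x
      = (\<integral>\<^sup>+z. ennreal (frac_kernel \<Omega> s b x z) * indicator {zero_ext \<Omega> u z..<zero_ext \<Omega> u x} t \<partial>lborel)"
    by (simp add: eq)
qed

text \<open>
  Tonelli's theorem: for fixed \<open>x\<close> and \<open>z\<close>, the levels \<open>t\<close> with \<open>u z \<le> t < u x\<close> form an interval of
  length at most \<open>\<bar>u z - u x\<bar>\<close>.
\<close>

lemma
  shows measurable_level_perimeter [measurable]: "level_perimeter \<Omega> s b u \<in> borel_measurable borel"
    and fractional_coarea: "(\<integral>\<^sup>+t. level_perimeter \<Omega> s b u t \<partial>lborel) \<le> frac_energy \<Omega> s b u"
proof -
  have \<Omega> [measurable]: "\<Omega> \<in> sets borel" using op by simp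
  have ind: "indicator {zero_ext \<Omega> u z..<zero_ext \<Omega> u x} t
      = (indicator {p. zero_ext \<Omega> u (snd (snd p)) \<le> fst p \<and> fst p < zero_ext \<Omega> u (fst (snd p))} (t, x, z) :: ennreal)"
    for t x z by (auto split: split_indicator)
  have [measurable]: "Measurable.pred (borel \<Otimes>\<^sub>M borel \<Otimes>\<^sub>M borel)
      (\<lambda>p. zero_ext \<Omega> u (snd (snd p)) \<le> fst p \<and> fst p < zero_ext \<Omega> u (fst (snd p)))" by measurable
  show [measurable]: "level_perimeter \<Omega> s b u \<in> borel_measurable borel"
    unfolding level_perimeter_def ind by measurable
  have "(\<integral>\<^sup>+t. level_perimeter \<Omega> s b u t \<partial>lborel) = (\<integral>\<^sup>+x. (\<integral>\<^sup>+t. (\<integral>\<^sup>+z. ennreal (frac_kernel \<Omega> s b x z) *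
    indicator {zero_ext \<Omega> u z..<zero_ext \<Omega> u x} t \<partial>lborel) \<partial>lborel) \<partial>lborel)"
    unfolding level_perimeter_def ind by (rule lborel_pair.Fubini') measurable
  also have "\<dots> = (\<integral>\<^sup>+x. (\<integral>\<^sup>+z. (\<integral>\<^sup>+t. ennreal (frac_kernel \<Omega> s b x z) *
    indicator {zero_ext \<Omega> u z..<zero_ext \<Omega> u x} t \<partial>lborel) \<partial>lborel) \<partial>lborel)"
    unfolding ind by (intro nn_integral_cong lborel_pair.Fubini') measurable
  also have "\<dots> \<le> (\<integral>\<^sup>+x. (\<integral>\<^sup>+z. ennreal (frac_kernel \<Omega> s b x z * \<bar>u z - u x\<bar>) \<partial>lborel) \<partial>lborel)"
  proof (intro nn_integral_mono)
    fix x z :: 'a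
    have "(\<integral>\<^sup>+t. ennreal (frac_kernel \<Omega> s b x z) * indicator {zero_ext \<Omega> u z..<zero_ext \<Omega> u x} t \<partial>lborel)
        = ennreal (frac_kernel \<Omega> s b x z) * emeasure lborel {zero_ext \<Omega> u z..<zero_ext \<Omega> u x}"
      by (rule nn_integral_cmult_indicator) simp
    also have "\<dots> \<le> ennreal (frac_kernel \<Omega> s b x z) * ennreal \<bar>zero_ext \<Omega> u z - zero_ext \<Omega> u x\<bar>"
      by (cases "zero_ext \<Omega> u z \<le> zero_ext \<Omega> u x") (auto intro!: mult_left_mono ennreal_leI)
    also have "\<dots> = ennreal (frac_kernel \<Omega> s b x z * \<bar>u z - u x\<bar>)"
      using frac_kernel_nonzero_in[of x z]
      by (cases "frac_kernel \<Omega> s b x z = 0") (auto simp: zero_ext_def ennreal_mult)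
    finally show "(\<integral>\<^sup>+t. ennreal (frac_kernel \<Omega> s b x z) * indicator {zero_ext \<Omega> u z..<zero_ext \<Omega> u x} t \<partial>lborel)
        \<le> ennreal (frac_kernel \<Omega> s b x z * \<bar>u z - u x\<bar>)" .
  qed
  finally show "(\<integral>\<^sup>+t. level_perimeter \<Omega> s b u t \<partial>lborel) \<le> frac_energy \<Omega> s b u"
    by (simp add: frac_energy_altdef)
qed

text \<open>
  Since \<open>{u > 0}\<close> fills at most half of the central ball, so does every \<open>{u > t}\<close> with \<open>t > 0\<close>, and the
  isoperimetric inequality applies to all these sets. It says that the \<open>q\<close>-th root of the measure of
  \<open>{u > t}\<close> is at most a multiple of its perimeter, whose integral over \<open>t\<close> is at most the energy.
\<close>

lemma positive_part_Lq_le_energy: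
  assumes q: "1 \<le> q" and C: "0 < C"
    and iso: "\<And>E. open E \<Longrightarrow> E \<subseteq> \<Omega> \<Longrightarrow>
      measure lborel (E \<inter> ball 0 r) \<le> measure lborel (ball 0 r :: 'a set) / 2 \<Longrightarrow>
      frac_perimeter \<Omega> s b E < \<infinity> \<Longrightarrow>
      emeasure (dist_measure \<Omega> a) E \<le> ennreal ((C * enn2real (frac_perimeter \<Omega> s b E)) powr q)"
    and half: "measure lborel ({x \<in> \<Omega>. 0 < u x} \<inter> ball 0 r) \<le> measure lborel (ball 0 r :: 'a set) / 2"
    and fin: "frac_energy \<Omega> s b u < \<infinity>"
  shows "(\<integral>\<^sup>+x. ennreal (max (zero_ext \<Omega> u x) 0 powr q) \<partial>dist_measure \<Omega> a)
    \<le> ennreal (q * (C * enn2real (frac_energy \<Omega> s b u)) powr q)"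
proof (rule nn_integral_powr_le_of_level_sets[where P = "\<lambda>t. ennreal C * level_perimeter \<Omega> s b u t"])
  have [measurable]: "\<Omega> \<in> sets borel" using op by simp
  show "sigma_finite_measure (dist_measure \<Omega> a)"
    unfolding dist_measure_def
    by (subst sigma_finite_measure.sigma_finite_iff_density_finite[OF sigma_finite_lborel])
      (auto split: split_indicator simp: ennreal_mult_eq_top_iff)
  show "(\<integral>\<^sup>+t. ennreal C * level_perimeter \<Omega> s b u t \<partial>lborel) \<le> ennreal (C * enn2real (frac_energy \<Omega> s b u))"
    using fractional_coarea C fin
    by (simp add: nn_integral_cmult ennreal_mult mult_left_mono less_top)
  fix t :: real
  assume t: "0 < t" and Pt: "ennreal C * level_perimeter \<Omega> s b u t < \<infinity>"
  define E where "E = {x \<in> \<Omega>. t < u x}"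
  have E: "open E" "E \<subseteq> \<Omega>" by (auto simp: E_def open_superlevel[OF u op])
  have "open {x \<in> \<Omega>. 0 < u x}" by (rule open_superlevel[OF u op])
  then have "measure lborel (E \<inter> ball 0 r) \<le> measure lborel ({x \<in> \<Omega>. 0 < u x} \<inter> ball 0 r)"
    using E(1) t by (intro measure_lborel_mono) (auto simp: E_def)
  with half have halfE: "measure lborel (E \<inter> ball 0 r) \<le> measure lborel (ball 0 r :: 'a set) / 2" by simp
  have "frac_perimeter \<Omega> s b E < \<infinity>"
    using Pt C by (auto simp: E_def frac_perimeter_superlevel ennreal_mult_less_top)
  from iso[OF E halfE this]
  have "emeasure (dist_measure \<Omega> a) E \<le> ennreal ((C * enn2real (level_perimeter \<Omega> s b u t)) powr q)"
    by (simp add: E_def frac_perimeter_superlevel)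
  moreover have "{x \<in> space (dist_measure \<Omega> a). t < max (zero_ext \<Omega> u x) 0} = E"
    using t by (auto simp: E_def zero_ext_def split: if_splits)
  ultimately show "emeasure (dist_measure \<Omega> a) {x \<in> space (dist_measure \<Omega> a). t < max (zero_ext \<Omega> u x) 0}
      \<le> ennreal (enn2real (ennreal C * level_perimeter \<Omega> s b u t) powr q)"
    using C by (simp add: enn2real_mult)
qed (use q C in auto)

end

section \<open>Medians and the inequality for functions\<close>

text \<open>
  The infimum \<open>m\<close> of the levels above which \<open>f\<close> has at most half of the volume is a median: the sets
  \<open>{f > m}\<close> and \<open>{f < m}\<close> are the increasing unions of \<open>{f > m + 1/k}\<close> and of \<open>{f < m - 1/k}\<close>, and
  these have at most half of the volume because \<open>m + 1/k\<close> lies above such a level and \<open>m - 1/k\<close> is not one.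
\<close>

lemma exists_median:
  fixes f :: "'a::euclidean_space \<Rightarrow> real"
  assumes B: "open B" "bounded B" "B \<noteq> {}" and cont: "continuous_on B f" and bdf: "bounded (f ` B)"
  obtains m where "measure lborel {x \<in> B. m < f x} \<le> measure lborel B / 2"
    "measure lborel {x \<in> B. f x < m} \<le> measure lborel B / 2"
proof -
  define h where "h = measure lborel B / 2"
  note open_level [simp] = open_superlevel[OF cont B(1)]
  have fin: "emeasure lborel S < \<infinity>" if "S \<subseteq> B" for S
    by (rule emeasure_bounded_finite[OF bounded_subset[OF B(2) that]])
  have em: "emeasure lborel S = ennreal (measure lborel S)" if "S \<subseteq> B" for S
    using fin[OF that] by (intro emeasure_eq_ennreal_measure) auto
  have mono: "measure lborel S \<le> measure lborel S'" if "S \<subseteq> S'" "S' \<subseteq> B" "open S" "open S'" for S S'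
    using that bounded_subset[OF B(2)] by (intro measure_lborel_mono) auto
  have "measure lborel B > 0"
  proof -
    obtain x e where "e > 0" "ball x e \<subseteq> B" using B by (meson ex_in_conv openE)
    then show ?thesis using mono[of "ball x e" B] B(1) content_ball_gt_0_iff[of x e]
      by (metis open_ball order_less_le_trans subset_refl)
  qed
  then have h: "0 < h" "h < measure lborel B" by (auto simp: h_def)
  obtain K where K: "\<And>x. x \<in> B \<Longrightarrow> \<bar>f x\<bar> \<le> K" using bdf by (auto simp: bounded_iff)
  define S where "S = {t. measure lborel {x \<in> B. t < f x} \<le> h}"
  have "K \<in> S"
  proof -
    have "{x \<in> B. K < f x} = {}" using K by force
    then show ?thesis using h unfolding S_def mem_Collect_eq by (metis measure_empty less_imp_le)
  qed
  have below: "- K \<le> t" if "t \<in> S" for t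
  proof (rule ccontr)
    assume "\<not> - K \<le> t"
    then have "{x \<in> B. t < f x} = B" using K by (force simp: abs_le_iff)
    then show False using that h by (simp add: S_def)
  qed
  define m where "m = Inf S"
  have bdd: "bdd_below S" using below by (meson bdd_belowI)
  show ?thesis
  proof (rule that[of m])
    define A where "A = (\<lambda>k. {x \<in> B. m + 1 / real (Suc k) < f x})"
    have "emeasure lborel (\<Union>k. A k) = (SUP k. emeasure lborel (A k))"
    proof (rule SUP_emeasure_incseq[symmetric])
      show "incseq A"
        unfolding incseq_def A_def by (auto elim!: order_le_less_trans[rotated] intro!: divide_left_mono)
    qed (auto simp: A_def)
    also have "\<dots> \<le> ennreal h"
    proof (rule SUP_least)
      fix k
      obtain t where t: "t \<in> S" "t < m + 1 / real (Suc k)"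
        using cInf_lessD[of S "m + 1 / real (Suc k)"] \<open>K \<in> S\<close> by (auto simp: m_def)
      then have "measure lborel (A k) \<le> measure lborel {x \<in> B. t < f x}"
        by (intro mono) (auto simp: A_def)
      also have "\<dots> \<le> h" using t by (simp add: S_def)
      finally show "emeasure lborel (A k) \<le> ennreal h"
        by (subst em) (auto simp: A_def intro: ennreal_leI)
    qed
    also have "(\<Union>k. A k) = {x \<in> B. m < f x}"
    proof -
      have "\<exists>k. m + 1 / real (Suc k) < f x" if "m < f x" for x
        using reals_Archimedean[of "f x - m"] that by (auto simp: inverse_eq_divide field_simps)
      moreover have "m < f x" if "m + 1 / real (Suc k) < f x" for x k
        using that by (smt (verit) divide_nonneg_nonneg of_nat_0_le_iff)
      ultimately show ?thesis unfolding A_def by blast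
    qed
    finally show "measure lborel {x \<in> B. m < f x} \<le> measure lborel B / 2"
      using h by (subst (asm) em) (auto simp: h_def)
  next
    define A where "A = (\<lambda>k. {x \<in> B. f x < m - 1 / real (Suc k)})"
    have "emeasure lborel (\<Union>k. A k) = (SUP k. emeasure lborel (A k))"
    proof (rule SUP_emeasure_incseq[symmetric])
      show "incseq A"
        unfolding incseq_def A_def by (auto elim!: order_less_le_trans intro!: divide_left_mono)
    qed (auto simp: A_def)
    also have "\<dots> \<le> ennreal h"
    proof (rule SUP_least)
      fix k
      define t where "t = m - 1 / real (Suc k)"
      have "t < m" by (simp add: t_def)
      then have "t \<notin> S" using cInf_lower[OF _ bdd, of t] by (auto simp: m_def)
      then have "h < measure lborel ({x \<in> B. t < f x} \<inter> B)" 
        by (simp add: S_def Int_absorb2)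
      moreover have "measure lborel (A k) \<le> measure lborel (B - {x \<in> B. t < f x})"
        using B by (intro measure_lborel_mono) (auto simp: A_def t_def)
      moreover have "measure lborel (B - {x \<in> B. t < f x})
          = measure lborel B - measure lborel ({x \<in> B. t < f x} \<inter> B)"
        by (rule measure_diff_bounded) (use B in auto)
      ultimately have "measure lborel (A k) \<le> h" by (simp add: h_def)
      then show "emeasure lborel (A k) \<le> ennreal h"
        by (subst em) (auto simp: A_def intro: ennreal_leI)
    qed
    also have "(\<Union>k. A k) = {x \<in> B. f x < m}"
    proof -
      have "\<exists>k. f x < m - 1 / real (Suc k)" if "f x < m" for x
        using reals_Archimedean[of "m - f x"] that by (auto simp: inverse_eq_divide field_simps)
      moreover have "f x < m" if "f x < m - 1 / real (Suc k)" for x k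
        using that by (smt (verit) divide_nonneg_nonneg of_nat_0_le_iff)
      ultimately show ?thesis unfolding A_def by blast
    qed
    finally show "measure lborel {x \<in> B. f x < m} \<le> measure lborel B / 2"
      using h by (subst (asm) em) (auto simp: h_def)
  qed
qed

lemma epowr_le:
  assumes "X \<le> ennreal Y" "0 \<le> Y" "0 \<le> p"
  shows "epowr X p \<le> ennreal (Y powr p)"
proof -
  have "X \<noteq> \<infinity>" using assms(1) by (auto simp: top_unique)
  moreover have "enn2real X \<le> Y" using assms by (simp add: enn2real_leI)
  ultimately show ?thesis
    using assms by (auto simp: epowr_def intro!: ennreal_leI powr_mono2)
qed

text \<open>
  The constant \<open>c\<close> is a median \<open>m\<close> of \<open>f\<close> on the central ball, so that both \<open>f - m\<close> and \<open>m - f\<close> are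
  positive on at most half of it. Their positive parts have disjoint supports, and the \<open>q\<close>-th powers of
  their norms add up to that of \<open>f - m\<close>.
\<close>

theorem John_fractional_Sobolev_Poincare:
  fixes \<Omega> :: "'a::euclidean_space set" and s q a b :: real
  assumes J: "John_domain \<Omega>" and s: "0 < s" "s < 1"
    and q: "1 \<le> q" "q \<le> real DIM('a) / (real DIM('a) - s)" and a: "a \<ge> 0"
    and b: "b \<le> (real DIM('a) + a) / q - real DIM('a) + s"
  obtains C :: real where "C > 0"
    "\<And>f. continuous_on \<Omega> f \<Longrightarrow>
      (INF c. wLq_norm \<Omega> q a (\<lambda>y. f y - c)) \<le> ennreal C * frac_energy \<Omega> s b f"
proof -
  have op: "open \<Omega>" and bd: "bounded \<Omega>" and zero: "0 \<in> \<Omega>"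
    using J by (auto simp: John_domain_def)
  have [measurable]: "\<Omega> \<in> sets borel" using op by simp
  obtain r C where r: "r > 0" and C: "C > 0" and sub: "cball 0 r \<subseteq> \<Omega>"
    and iso: "\<And>E. open E \<Longrightarrow> E \<subseteq> \<Omega> \<Longrightarrow>
      measure lborel (E \<inter> ball 0 r) \<le> measure lborel (ball 0 r :: 'a set) / 2 \<Longrightarrow>
      frac_perimeter \<Omega> s b E < \<infinity> \<Longrightarrow>
      emeasure (dist_measure \<Omega> a) E \<le> ennreal ((C * enn2real (frac_perimeter \<Omega> s b E)) powr q)"
    by (rule John_fractional_isoperimetric[OF J s q a b]) blast
  define C' where "C' = (2 * q) powr (1 / q) * C"
  have C': "C' > 0" using C q by (simp add: C'_def)
  have "(INF c. wLq_norm \<Omega> q a (\<lambda>y. f y - c)) \<le> ennreal C' * frac_energy \<Omega> s b f"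
    if f: "continuous_on \<Omega> f" for f
  proof (cases "frac_energy \<Omega> s b f < \<infinity>")
    case False
    then show ?thesis using C' by (simp add: not_less top_unique ennreal_mult_top)
  next
    case True
    define \<rho> where "\<rho> = enn2real (frac_energy \<Omega> s b f)"
    have \<rho>: "frac_energy \<Omega> s b f = ennreal \<rho>" "0 \<le> \<rho>" using True by (simp_all add: \<rho>_def less_top)
    have ballsub: "ball 0 r \<subseteq> \<Omega>" using sub ball_subset_cball by blast
    have "compact (f ` cball 0 r)"
      by (rule compact_continuous_image[OF continuous_on_subset[OF f sub]]) simp
    then have "bounded (f ` ball 0 r)"
      using bounded_subset[OF compact_imp_bounded] by (meson ball_subset_cball image_mono)
    then obtain m where m: "measure lborel {x \<in> ball 0 r. m < f x} \<le> measure lborel (ball 0 r :: 'a set) / 2"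
        "measure lborel {x \<in> ball 0 r. f x < m} \<le> measure lborel (ball 0 r :: 'a set) / 2"
      using exists_median[of "ball 0 r" f] continuous_on_subset[OF f ballsub] r by auto
    define u v where "u = (\<lambda>x. f x - m)" and "v = (\<lambda>x. m - f x)"
    have cont: "continuous_on \<Omega> u" "continuous_on \<Omega> v"
      unfolding u_def v_def by (intro continuous_intros f)+
    have en: "frac_energy \<Omega> s b u = ennreal \<rho>" "frac_energy \<Omega> s b v = ennreal \<rho>"
      unfolding \<rho>(1)[symmetric] frac_energy_def u_def v_def by (simp_all add: abs_minus_commute)
    have eq: "{x \<in> \<Omega>. 0 < u x} \<inter> ball 0 r = {x \<in> ball 0 r. m < f x}"
        "{x \<in> \<Omega>. 0 < v x} \<inter> ball 0 r = {x \<in> ball 0 r. f x < m}"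
      using ballsub by (auto simp: u_def v_def)
    have half: "(\<integral>\<^sup>+x. ennreal (max (zero_ext \<Omega> w x) 0 powr q) \<partial>dist_measure \<Omega> a)
        \<le> ennreal (q * (C * \<rho>) powr q)" if "w = u \<or> w = v" for w
      using positive_part_Lq_le_energy[OF op bd zero _ q(1) C iso, of w] that cont en eq m \<rho> by auto
    have mw: "(\<lambda>x. ennreal (max (zero_ext \<Omega> w x) 0 powr q)) \<in> borel_measurable (dist_measure \<Omega> a)"
      if "w = u \<or> w = v" for w
    proof -
      have [measurable]: "zero_ext \<Omega> w \<in> borel_measurable borel"
        using measurable_zero_ext[OF op bd zero, of w] cont that by auto
      show ?thesis by measurable
    qed
    have "(\<integral>\<^sup>+y\<in>\<Omega>. ennreal (\<bar>f y - m\<bar> powr q * bdist \<Omega> y powr a) \<partial>lborel)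
        = (\<integral>\<^sup>+y. (ennreal (bdist \<Omega> y powr a) * indicator \<Omega> y) *
            (ennreal (max (zero_ext \<Omega> u y) 0 powr q) + ennreal (max (zero_ext \<Omega> v y) 0 powr q)) \<partial>lborel)"
    proof (rule nn_integral_cong)
      fix y
      show "ennreal (\<bar>f y - m\<bar> powr q * bdist \<Omega> y powr a) * indicator \<Omega> y
        = (ennreal (bdist \<Omega> y powr a) * indicator \<Omega> y) *
            (ennreal (max (zero_ext \<Omega> u y) 0 powr q) + ennreal (max (zero_ext \<Omega> v y) 0 powr q))"
        using zero_ext_def[of \<Omega> u] zero_ext_def[of \<Omega> v]
        by (cases "y \<in> \<Omega>"; cases "m \<le> f y")
           (auto simp: u_def v_def ennreal_mult mult_ac)
    qed
    also have "\<dots> = (\<integral>\<^sup>+y. (ennreal (max (zero_ext \<Omega> u y) 0 powr q)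
        + ennreal (max (zero_ext \<Omega> v y) 0 powr q)) \<partial>dist_measure \<Omega> a)"
      unfolding dist_measure_def
      by (rule nn_integral_density[symmetric])
         (use mw[of u] mw[of v] in \<open>auto simp: dist_measure_def\<close>)
    also have "\<dots> = (\<integral>\<^sup>+y. ennreal (max (zero_ext \<Omega> u y) 0 powr q) \<partial>dist_measure \<Omega> a)
        + (\<integral>\<^sup>+y. ennreal (max (zero_ext \<Omega> v y) 0 powr q) \<partial>dist_measure \<Omega> a)"
      by (rule nn_integral_add) (use mw in auto)
    also have "\<dots> \<le> ennreal (q * (C * \<rho>) powr q) + ennreal (q * (C * \<rho>) powr q)"
      by (intro add_mono half) auto
    also have "\<dots> = ennreal (2 * q * (C * \<rho>) powr q)"
      using q by (simp add: ennreal_plus[symmetric] del: ennreal_plus)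
    finally have le: "(\<integral>\<^sup>+y\<in>\<Omega>. ennreal (\<bar>f y - m\<bar> powr q * bdist \<Omega> y powr a) \<partial>lborel)
      \<le> ennreal (2 * q * (C * \<rho>) powr q)" .
    have "wLq_norm \<Omega> q a (\<lambda>y. f y - m) \<le> ennreal ((2 * q * (C * \<rho>) powr q) powr (1 / q))"
      unfolding wLq_norm_def by (rule epowr_le[OF le]) (use q in auto)
    also have "(2 * q * (C * \<rho>) powr q) powr (1 / q) = C' * \<rho>"
      using q C \<rho> by (simp add: C'_def powr_mult powr_powr)
    finally have "wLq_norm \<Omega> q a (\<lambda>y. f y - m) \<le> ennreal C' * frac_energy \<Omega> s b f"
      using C' \<rho> by (simp add: ennreal_mult)
    then show ?thesis by (rule INF_lower2[OF UNIV_I])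
  qed
  then show ?thesis using that[OF C'] by blast
qed

theorem theorem3p2:
  fixes \<Omega> :: "(real ^ 'n) set" and s q a b :: real
  assumes "CARD('n) \<ge> 2"
    and "John_domain \<Omega>"
    and "0 < s" and "s < 1"
    and "1 \<le> q" and "q \<le> real CARD('n) / (real CARD('n) - s)"
    and "a \<ge> 0"
    and "b \<le> (real CARD('n) + a) / q - real CARD('n) + s"
  shows "\<exists>C::real. C > 0 \<and>
    (\<forall>f :: real ^ 'n \<Rightarrow> real. Cinf_on \<Omega> f \<longrightarrow>
      (INF c::real. wLq_norm \<Omega> q a (\<lambda>y. f y - c))
      \<le> ennreal C *
        (\<integral>\<^sup>+x\<in>\<Omega>.
          (\<integral>\<^sup>+z\<in>{z. norm (x - z) \<le> bdist \<Omega> x / 2}.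
            ennreal (\<bar>f z - f x\<bar> / norm (z - x) powr (real CARD('n) + s) * bdist2 \<Omega> x z powr b)
            \<partial>lborel)
          \<partial>lborel))"
proof -
  have dim: "DIM(real ^ 'n) = CARD('n)" by simp
  obtain C where C: "C > 0" "\<And>f. continuous_on \<Omega> f \<Longrightarrow>
      (INF c. wLq_norm \<Omega> q a (\<lambda>y. f y - c)) \<le> ennreal C * frac_energy \<Omega> s b f"
    by (rule John_fractional_Sobolev_Poincare[where \<Omega> = \<Omega> and s = s and q = q and a = a and b = b])
       (use assms in auto)
  show ?thesis
  proof (intro exI[of _ C] conjI allI impI)
    fix f :: "real ^ 'n \<Rightarrow> real" assume "Cinf_on \<Omega> f"
    then have "Ck_on 0 \<Omega> f" unfolding Cinf_on_def by blast
    then have "continuous_on \<Omega> f" by simp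
    from C(2)[OF this] show "(INF c::real. wLq_norm \<Omega> q a (\<lambda>y. f y - c))
      \<le> ennreal C *
        (\<integral>\<^sup>+x\<in>\<Omega>.
          (\<integral>\<^sup>+z\<in>{z. norm (x - z) \<le> bdist \<Omega> x / 2}.
            ennreal (\<bar>f z - f x\<bar> / norm (z - x) powr (real CARD('n) + s) * bdist2 \<Omega> x z powr b)
            \<partial>lborel)
          \<partial>lborel)"
      unfolding frac_energy_def dim .
  qed (rule C(1))
qed

end
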